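(* Let $D$ be a (possibly unbounded) self-adjoint operator on a Hilbert space $H$ and let $a$ be a bounded operator on $H$. Then $a$ is uniformly $D$-differentiable if and only if it is weakly $D$-differentiable and the function $t\mapsto\alpha_t(\delta_w^D(a))$ from $\mathbb{R}$ to $B(H)$ is norm continuous.
   Context: $B(H)$ is the algebra of bounded operators on $H$ with operator norm $\|\cdot\|$. For $t\in\mathbb{R}$ and $a\in B(H)$ let $\alpha_t(a):=e^{itD}ae^{-itD}$. An operator $a\in B(H)$ is uniformly $D$-differentiable if there is a bounded operator $b$ on $H$ with $\lim_{t\to0}\|\frac{\alpha_t(a)-a}{t}-b\|=0$. An operator $a\in B(H)$ is weakly $D$-differentiable if there is a bounded operator $b$ on $H$ with $\lim_{t\to0}|\langle(\frac{\alpha_t(a)-a}{t}-b)\xi,\eta\rangle|=0$ for all $\xi,\eta\in H$; then $b$ is called the weak $D$-derivative of $a$ and denoted $\delta_w^D(a)$. *)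

theory Defs
  imports "HOL-Analysis.Analysis"
begin

class complex_vector = real_vector +
  fixes scaleC :: "complex \<Rightarrow> 'a \<Rightarrow> 'a"  (infixr \<open>*\<^sub>C\<close> 75)
  assumes scaleC_add_right: "c *\<^sub>C (x + y) = c *\<^sub>C x + c *\<^sub>C y"
    and scaleC_add_left: "(c + d) *\<^sub>C x = c *\<^sub>C x + d *\<^sub>C x"
    and scaleC_scaleC: "c *\<^sub>C (d *\<^sub>C x) = (c * d) *\<^sub>C x"
    and scaleC_of_real: "complex_of_real r *\<^sub>C x = r *\<^sub>R x"

text \<open>The inner product is linear in the first argument and conjugate linear in the second.\<close>

class complex_inner = complex_vector + real_normed_vector +
  fixes cinner :: "'a \<Rightarrow> 'a \<Rightarrow> complex"
  assumes cinner_commute: "cinner x y = cnj (cinner y x)"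
    and cinner_add_left: "cinner (x + y) z = cinner x z + cinner y z"
    and cinner_scaleC_left: "cinner (c *\<^sub>C x) y = c * cinner x y"
    and cinner_ge_zero: "0 \<le> Re (cinner x x)"
    and cinner_eq_zero_iff: "cinner x x = 0 \<longleftrightarrow> x = 0"
    and norm_eq_sqrt_cinner: "norm x = sqrt (Re (cinner x x))"

class chilbert_space = complex_inner + complete_space

instantiation complex :: chilbert_space
begin

definition "scaleC c (x :: complex) = c * x"
definition "cinner x (y :: complex) = x * cnj y"

instance
proof
  fix x y z c d :: complex and r :: real
  show "c *\<^sub>C (x + y) = c *\<^sub>C x + c *\<^sub>C y"
    by (simp add: scaleC_complex_def distrib_left)
  show "(c + d) *\<^sub>C x = c *\<^sub>C x + d *\<^sub>C x"
    by (simp add: scaleC_complex_def distrib_right)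
  show "c *\<^sub>C (d *\<^sub>C x) = (c * d) *\<^sub>C x"
    by (simp add: scaleC_complex_def mult.assoc)
  show "complex_of_real r *\<^sub>C x = r *\<^sub>R x"
    by (simp add: scaleC_complex_def scaleR_conv_of_real)
  show "cinner x y = cnj (cinner y x)"
    by (simp add: cinner_complex_def mult.commute)
  show "cinner (x + y) z = cinner x z + cinner y z"
    by (simp add: cinner_complex_def distrib_right)
  show "cinner (c *\<^sub>C x) y = c * cinner x y"
    by (simp add: cinner_complex_def scaleC_complex_def mult.assoc)
  show "0 \<le> Re (cinner x x)"
    by (simp add: cinner_complex_def)
  show "cinner x x = 0 \<longleftrightarrow> x = 0"
    by (simp add: cinner_complex_def)
  show "norm x = sqrt (Re (cinner x x))"
    by (simp add: cinner_complex_def cmod_def power2_eq_square)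
qed

end

text \<open>
  The library type \<open>'a \<Rightarrow>\<^sub>L 'a\<close> consists of the bounded \<^emph>\<open>real\<close> linear maps, normed by the
  operator norm.  The algebra \<open>B(H)\<close> is the subset of complex linear ones, with the
  same norm.
\<close>

definition BH :: "('a::complex_inner \<Rightarrow>\<^sub>L 'a) set" where
  "BH = {A. \<forall>c x. blinfun_apply A (c *\<^sub>C x) = c *\<^sub>C blinfun_apply A x}"

definition unitary_op :: "('a::complex_inner \<Rightarrow>\<^sub>L 'a) \<Rightarrow> bool" where
  "unitary_op A \<longleftrightarrow> A \<in> BH \<and> surj (blinfun_apply A) \<and>
     (\<forall>x y. cinner (blinfun_apply A x) (blinfun_apply A y) = cinner x y)"

text \<open>
  An unbounded operator is given by its domain \<open>S\<close> and a total function \<open>D\<close>, whose values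
  outside \<open>S\<close> are irrelevant: the notions below only depend on \<open>op_graph S D\<close>.
\<close>

definition op_graph :: "'a set \<Rightarrow> ('a \<Rightarrow> 'a) \<Rightarrow> ('a \<times> 'a) set" where
  "op_graph S D = {(x, D x) | x. x \<in> S}"

definition adjoint_graph :: "'a::complex_inner set \<Rightarrow> ('a \<Rightarrow> 'a) \<Rightarrow> ('a \<times> 'a) set" where
  "adjoint_graph S D = {(y, z). \<forall>x\<in>S. cinner (D x) y = cinner x z}"

definition densely_defined_operator :: "'a::complex_inner set \<Rightarrow> ('a \<Rightarrow> 'a) \<Rightarrow> bool" where
  "densely_defined_operator S D \<longleftrightarrow>
     0 \<in> S \<and> (\<forall>x\<in>S. \<forall>y\<in>S. x + y \<in> S \<and> D (x + y) = D x + D y) \<and>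
     (\<forall>c. \<forall>x\<in>S. c *\<^sub>C x \<in> S \<and> D (c *\<^sub>C x) = c *\<^sub>C D x) \<and>
     closure S = UNIV"

definition self_adjoint :: "'a::complex_inner set \<Rightarrow> ('a \<Rightarrow> 'a) \<Rightarrow> bool" where
  "self_adjoint S D \<longleftrightarrow> densely_defined_operator S D \<and> adjoint_graph S D = op_graph S D"

definition strongly_continuous_unitary_group ::
    "(real \<Rightarrow> 'a::complex_inner \<Rightarrow>\<^sub>L 'a) \<Rightarrow> bool" where
  "strongly_continuous_unitary_group U \<longleftrightarrow>
     (\<forall>t. unitary_op (U t)) \<and> U 0 = id_blinfun \<and> (\<forall>s t. U (s + t) = U s o\<^sub>L U t) \<and>
     (\<forall>x. continuous_on UNIV (\<lambda>t. blinfun_apply (U t) x))"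

definition generator_graph :: "(real \<Rightarrow> 'a::complex_inner \<Rightarrow>\<^sub>L 'a) \<Rightarrow> ('a \<times> 'a) set" where
  "generator_graph U =
     {(x, y). ((\<lambda>t. (1 / t) *\<^sub>R (blinfun_apply (U t) x - x)) \<longlongrightarrow> y) (at 0)}"

text \<open>
  For self-adjoint \<open>D\<close> with domain \<open>S\<close>, \<open>exp_i S D t\<close> is \<open>e\<^sup>i\<^sup>t\<^sup>D\<close>: the unique strongly
  continuous one-parameter unitary group with infinitesimal generator \<open>iD\<close> (including
  equality of domains).  By Stone's theorem it exists, and it coincides with \<open>e\<^sup>i\<^sup>t\<^sup>D\<close> in the
  functional calculus of \<open>D\<close>.
\<close>

definition exp_i :: "'a::complex_inner set \<Rightarrow> ('a \<Rightarrow> 'a) \<Rightarrow> real \<Rightarrow> 'a \<Rightarrow>\<^sub>L 'a" where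
  "exp_i S D = (THE U. strongly_continuous_unitary_group U \<and>
     generator_graph U = op_graph S (\<lambda>x. \<i> *\<^sub>C D x))"

definition flow ::
    "'a::complex_inner set \<Rightarrow> ('a \<Rightarrow> 'a) \<Rightarrow> real \<Rightarrow> ('a \<Rightarrow>\<^sub>L 'a) \<Rightarrow> ('a \<Rightarrow>\<^sub>L 'a)" where
  "flow S D t a = exp_i S D t o\<^sub>L a o\<^sub>L exp_i S D (- t)"

definition uniformly_differentiable ::
    "'a::complex_inner set \<Rightarrow> ('a \<Rightarrow> 'a) \<Rightarrow> ('a \<Rightarrow>\<^sub>L 'a) \<Rightarrow> bool" where
  "uniformly_differentiable S D a \<longleftrightarrow>
     (\<exists>b\<in>BH. ((\<lambda>t. norm ((1 / t) *\<^sub>R (flow S D t a - a) - b)) \<longlongrightarrow> 0) (at 0))"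

definition has_weak_derivative ::
    "'a::complex_inner set \<Rightarrow> ('a \<Rightarrow> 'a) \<Rightarrow> ('a \<Rightarrow>\<^sub>L 'a) \<Rightarrow> ('a \<Rightarrow>\<^sub>L 'a) \<Rightarrow> bool" where
  "has_weak_derivative S D a b \<longleftrightarrow> b \<in> BH \<and>
     (\<forall>\<xi> \<eta>. ((\<lambda>t. cmod (cinner
        (blinfun_apply ((1 / t) *\<^sub>R (flow S D t a - a) - b) \<xi>) \<eta>)) \<longlongrightarrow> 0) (at 0))"

definition weakly_differentiable ::
    "'a::complex_inner set \<Rightarrow> ('a \<Rightarrow> 'a) \<Rightarrow> ('a \<Rightarrow>\<^sub>L 'a) \<Rightarrow> bool" where
  "weakly_differentiable S D a \<longleftrightarrow> (\<exists>b. has_weak_derivative S D a b)"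

definition weak_derivative ::
    "'a::complex_inner set \<Rightarrow> ('a \<Rightarrow> 'a) \<Rightarrow> ('a \<Rightarrow>\<^sub>L 'a) \<Rightarrow> ('a \<Rightarrow>\<^sub>L 'a)" where
  "weak_derivative S D a = (THE b. has_weak_derivative S D a b)"

end

theory Submission
  imports Defs
begin

text \<open>
  Write \<open>U\<^sub>t\<close> for \<open>e\<^sup>i\<^sup>t\<^sup>D\<close> and \<open>\<alpha>\<^sub>t(a) = U\<^sub>t a U\<^sub>-\<^sub>t\<close>.  The \<open>\<alpha>\<^sub>t\<close> form a one-parameter group of linear
  isometries of the bounded operators, and this alone gives the forward direction: if the
  difference quotients of \<open>a\<close> at \<open>0\<close> tend to \<open>b\<close> in norm, then applying \<open>\<alpha>\<^sub>t\<close> shows that the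
  difference quotients at \<open>t\<close> tend to \<open>\<alpha>\<^sub>t(b)\<close>, uniformly in \<open>t\<close>.  Hence \<open>t \<mapsto> \<alpha>\<^sub>t(a)\<close> is norm
  continuous, the quotients are norm continuous functions of \<open>t\<close>, and so is their uniform limit
  \<open>\<alpha>\<^sub>t(b)\<close> (\<open>uniform_derivative_flow_continuous\<close>).

  Conversely, a weak derivative \<open>b\<close> makes every matrix coefficient \<open>\<langle>\<alpha>\<^sub>t(a)\<xi>, \<eta>\<rangle>\<close> differentiable for
  all \<open>t\<close>, with derivative \<open>\<langle>\<alpha>\<^sub>t(b)\<xi>, \<eta>\<rangle>\<close>, because \<open>U\<^sub>t\<close> can be moved to the vectors.  The mean value
  inequality bounds \<open>\<langle>(\<alpha>\<^sub>t(a) - a - t b)\<xi>, \<eta>\<rangle>\<close> by \<open>\<bar>t\<bar> \<parallel>\<xi>\<parallel> \<parallel>\<eta>\<parallel>\<close> times the supremum of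
  \<open>\<parallel>\<alpha>\<^sub>s(b) - b\<parallel>\<close> over \<open>\<bar>s\<bar> \<le> \<bar>t\<bar>\<close>.  The bound is uniform in the vectors, so it is a bound on the operator
  norm (\<open>norm_flow_increment_le\<close>), and norm continuity of \<open>\<alpha>\<^sub>s(b)\<close> at \<open>s = 0\<close> finishes the proof.

  Most of the work is Stone's theorem: that the group \<open>U\<close> with generator \<open>A = iD\<close> exists and is unique,
  so that \<open>exp_i\<close> denotes it.  Self-adjointness of \<open>D\<close> means that the adjoint of \<open>A\<close> is
  \<open>- A\<close>; by orthogonal projection, \<open>l - A\<close> is then a bijection onto the whole space for every real
  \<open>l \<noteq> 0\<close>.  The resolvents yield commuting bounded skew operators \<open>B\<^sub>n\<close> with \<open>B\<^sub>n x \<longlongrightarrow> A x\<close> on the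
  domain.  Their exponentials are isometric groups, and
  \<open>\<parallel>exp(t B\<^sub>n) x - exp(t B\<^sub>m) x\<parallel> \<le> \<bar>t\<bar> \<parallel>B\<^sub>n x - B\<^sub>m x\<parallel>\<close> makes them converge strongly to \<open>U\<close>.  Uniqueness, here
  and for the exponentials, is conservation of energy: a curve whose velocity is orthogonal to its
  position has constant norm.
\<close>

section \<open>Complex inner product spaces\<close>

instance chilbert_space \<subseteq> banach ..

lemma
  fixes x y :: "'a::complex_inner"
  shows cinner_add_right: "cinner x (y + z) = cinner x y + cinner x z"
    and cinner_scaleC_right: "cinner x (c *\<^sub>C y) = cnj c * cinner x y"
    and cinner_scaleR_left: "cinner (r *\<^sub>R x) y = r *\<^sub>R cinner x y"
    and cinner_scaleR_right: "cinner x (r *\<^sub>R y) = r *\<^sub>R cinner x y"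
proof -
  show "cinner x (y + z) = cinner x y + cinner x z"
    by (metis cinner_add_left cinner_commute complex_cnj_add)
  show *: "cinner x (c *\<^sub>C y) = cnj c * cinner x y" for c
    by (metis cinner_scaleC_left cinner_commute complex_cnj_mult)
  show "cinner (r *\<^sub>R x) y = r *\<^sub>R cinner x y"
    by (metis cinner_scaleC_left scaleC_of_real scaleR_conv_of_real)
  show "cinner x (r *\<^sub>R y) = r *\<^sub>R cinner x y"
    by (metis * scaleC_of_real scaleR_conv_of_real complex_cnj_complex_of_real)
qed

lemma power2_norm_eq_cinner: "(norm (x::'a::complex_inner))\<^sup>2 = Re (cinner x x)"
  by (simp add: norm_eq_sqrt_cinner cinner_ge_zero)

lemma norm_scaleC: "norm (c *\<^sub>C (x::'a::complex_inner)) = cmod c * norm x"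
proof -
  have "cinner (c *\<^sub>C x) (c *\<^sub>C x) = of_real ((cmod c)\<^sup>2) * cinner x x"
    by (simp add: cinner_scaleC_left cinner_scaleC_right mult.assoc[symmetric] complex_norm_square del: of_real_power)
  then have "(norm (c *\<^sub>C x))\<^sup>2 = (cmod c * norm x)\<^sup>2"
    by (simp add: power2_norm_eq_cinner power_mult_distrib)
  then show ?thesis
    by (metis abs_norm_cancel norm_ge_zero norm_mult power2_eq_iff_nonneg zero_le_mult_iff)
qed

lemma power2_norm_add:
  "(norm ((x::'a::complex_inner) + y))\<^sup>2 = (norm x)\<^sup>2 + (norm y)\<^sup>2 + 2 * Re (cinner x y)"
proof -
  have "Re (cinner y x) = Re (cinner x y)" by (subst cinner_commute) simp
  then show ?thesis by (simp add: power2_norm_eq_cinner cinner_add_left cinner_add_right)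
qed

lemma parallelogram_law:
  "(norm ((x::'a::complex_inner) + y))\<^sup>2 + (norm (x - y))\<^sup>2 = 2 * (norm x)\<^sup>2 + 2 * (norm y)\<^sup>2"
proof -
  have "cinner x (- y) = - cinner x y"
    using cinner_scaleR_right[of x "-1" y] by simp
  then show ?thesis
    using power2_norm_add[of x y] power2_norm_add[of x "- y"] by simp
qed

text \<open>The Cauchy-Schwarz inequality for the real part is the triangle inequality for the norm
  squared; rotating \<open>x\<close> by the phase of \<open>cinner x y\<close> gives the full inequality.\<close>

lemma norm_cinner_le: "cmod (cinner x y) \<le> norm (x::'a::complex_inner) * norm y"
proof -
  have re: "Re (cinner x y) \<le> norm x * norm y" for x y :: 'a
  proof -
    have "(norm (x + y))\<^sup>2 \<le> (norm x + norm y)\<^sup>2" by (simp add: norm_triangle_ineq power_mono)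
    then show ?thesis by (simp add: power2_norm_add power2_sum)
  qed
  show ?thesis
  proof (cases "cinner x y = 0")
    case False
    define c where "c = cnj (cinner x y) / cmod (cinner x y)"
    have "Re (cinner (c *\<^sub>C x) y) = cmod (cinner x y)"
      using False by (simp add: c_def cinner_scaleC_left divide_simps complex_norm_square[symmetric] power2_eq_square mult.commute[of "cnj _"])
    moreover have "cmod c = 1" using False by (simp add: c_def norm_divide)
    ultimately show ?thesis using re[of "c *\<^sub>C x" y] by (simp add: norm_scaleC)
  qed simp
qed

interpretation cinner: bounded_bilinear "cinner :: 'a::complex_inner \<Rightarrow> 'a \<Rightarrow> complex"
proof
  show "\<exists>K. \<forall>(x::'a) y. norm (cinner x y) \<le> norm x * norm y * K"
    using norm_cinner_le by (intro exI[of _ 1]) auto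
qed (simp_all add: cinner_add_left cinner_add_right cinner_scaleR_left cinner_scaleR_right)

lemma bounded_linear_scaleC: "bounded_linear ((*\<^sub>C) c :: 'a::complex_inner \<Rightarrow> 'a)"
proof (rule bounded_linear_intro)
  show "c *\<^sub>C (r *\<^sub>R x) = r *\<^sub>R c *\<^sub>C x" for r and x :: 'a
    by (metis scaleC_of_real scaleC_scaleC mult.commute)
  show "norm (c *\<^sub>C x) \<le> norm x * cmod c" for x :: 'a
    by (simp add: norm_scaleC)
qed (rule scaleC_add_right)

lemma cinner_eqI:
  assumes "\<And>z. cinner x z = cinner y z"
  shows "(x::'a::complex_inner) = y"
  using assms[of "x - y"] cinner_eq_zero_iff[of "x - y"] by (simp add: cinner.diff_left)

text \<open>Polarization: the norm determines the real part of the inner product, and the real part at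
  \<open>\<i> x\<close> determines the imaginary part at \<open>x\<close>.\<close>

lemma cinner_isometry:
  fixes A :: "'a::complex_inner \<Rightarrow>\<^sub>L 'a"
  assumes iso: "\<And>x. norm (A x) = norm x" and "A \<in> BH"
  shows "cinner (A x) (A y) = cinner x y"
proof -
  have re: "Re (cinner (A x) (A y)) = Re (cinner x y)" for x y
    using power2_norm_add[of "A x" "A y"] power2_norm_add[of x y] iso[of "x + y"]
    by (simp add: blinfun.add_right iso)
  have "Re (\<i> * cinner (A x) (A y)) = Re (\<i> * cinner x y)"
    using re[of "\<i> *\<^sub>C x" y] assms(2) by (simp add: BH_def cinner_scaleC_left)
  then show ?thesis by (simp add: complex_eq_iff re)
qed

section \<open>Orthogonal projection\<close>

text \<open>A sequence in \<open>M\<close> minimizing the distance to a given \<open>z\<close> is Cauchy by the parallelogram law, and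
  its limit \<open>p\<close> is the foot of the perpendicular: \<open>z - p\<close> is orthogonal to \<open>M\<close>, hence zero.\<close>

lemma closed_subspace_eq_UNIV:
  fixes M :: "'a::chilbert_space set"
  assumes sub: "subspace M" and cl: "closed M"
    and orth: "\<And>y. (\<forall>x\<in>M. Re (cinner x y) = 0) \<Longrightarrow> y = 0"
  shows "M = UNIV"
proof -
  have "z \<in> M" for z
  proof -
    define d where "d = infdist z M"
    have M0: "M \<noteq> {}" using sub subspace_0 by blast
    have d0: "d \<ge> 0" by (simp add: d_def infdist_nonneg)
    have dle: "d \<le> norm (z - m)" if "m \<in> M" for m
      using infdist_le[OF that, of z] by (simp add: d_def dist_norm)
    have "\<exists>m\<in>M. (norm (z - m))\<^sup>2 < d\<^sup>2 + 1 / Suc k" for k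
    proof (rule ccontr)
      assume "\<not> ?thesis"
      then have "sqrt (d\<^sup>2 + 1 / Suc k) \<le> dist z m" if "m \<in> M" for m
        using that by (force simp: dist_norm intro!: real_le_lsqrt)
      then have "sqrt (d\<^sup>2 + 1 / Suc k) \<le> d"
        unfolding d_def infdist_notempty[OF M0] by (intro cINF_greatest M0) auto
      then have "d\<^sup>2 + 1 / Suc k \<le> d\<^sup>2" using d0 real_sqrt_le_iff by (metis real_le_lsqrt sqrt_le_D)
      then show False by (simp add: field_simps)
    qed
    then obtain m where mM: "\<And>k. m k \<in> M" and m: "\<And>k. (norm (z - m k))\<^sup>2 < d\<^sup>2 + 1 / Suc k"
      by metis
    have par: "(norm (m i - m j))\<^sup>2 \<le> 2 / Suc i + 2 / Suc j" for i j
    proof -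
      let ?a = "z - m i" and ?b = "z - m j"
      have "(norm (?a + ?b))\<^sup>2 + (norm (?a - ?b))\<^sup>2 = 2 * (norm ?a)\<^sup>2 + 2 * (norm ?b)\<^sup>2"
        by (rule parallelogram_law)
      moreover have "?a + ?b = 2 *\<^sub>R (z - (1/2) *\<^sub>R (m i + m j))"
        by (simp add: algebra_simps scaleR_2)
      moreover have "d \<le> norm (z - (1/2) *\<^sub>R (m i + m j))"
        by (intro dle subspace_scale subspace_add sub mM)
      then have "d\<^sup>2 \<le> (norm (z - (1/2) *\<^sub>R (m i + m j)))\<^sup>2" using d0 by (simp add: power_mono)
      moreover have "?a - ?b = - (m i - m j)" by simp
      ultimately have "4 * d\<^sup>2 + (norm (m i - m j))\<^sup>2 \<le> 2 * (norm ?a)\<^sup>2 + 2 * (norm ?b)\<^sup>2"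
        by (simp add: power_mult_distrib norm_minus_commute)
      then show ?thesis using m[of i] m[of j] by argo
    qed
    have "Cauchy m"
    proof (rule metric_CauchyI)
      fix e :: real assume e: "e > 0"
      obtain N where N: "4 / e\<^sup>2 < real N" using reals_Archimedean2 by blast
      have "dist (m i) (m j) < e" if "i \<ge> N" "j \<ge> N" for i j
      proof -
        have N0: "real N > 0" using N e by (smt (verit) divide_pos_pos zero_less_power)
        have "2 / Suc i \<le> 2 / N" "2 / Suc j \<le> 2 / N" using that N0 by (auto simp: frac_le)
        then have "(norm (m i - m j))\<^sup>2 \<le> 4 / N" using par[of i j] by argo
        also have "\<dots> < e\<^sup>2" using N e N0 by (simp add: field_simps)
        finally show ?thesis using e by (simp add: dist_norm power2_less_imp_less)
      qed
      then show "\<exists>M. \<forall>i\<ge>M. \<forall>j\<ge>M. dist (m i) (m j) < e" by blast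
    qed
    then obtain p where p: "m \<longlonglongrightarrow> p" using Cauchy_convergent convergentD by blast
    have pM: "p \<in> M" using cl mM p closed_sequentially by blast
    have "(\<lambda>k. (norm (z - m k))\<^sup>2) \<longlonglongrightarrow> (norm (z - p))\<^sup>2"
      by (intro tendsto_intros p)
    moreover have "(\<lambda>k. d\<^sup>2 + 1 / Suc k) \<longlonglongrightarrow> d\<^sup>2 + 0"
      by (intro tendsto_intros LIMSEQ_Suc[OF lim_1_over_n])
    ultimately have "(norm (z - p))\<^sup>2 \<le> d\<^sup>2 + 0"
      by (rule LIMSEQ_le) (use m less_imp_le in blast)
    then have pd: "(norm (z - p))\<^sup>2 \<le> d\<^sup>2" by simp
    have "Re (cinner x (z - p)) = 0" if x: "x \<in> M" for x
    proof -
      define r where "r = Re (cinner x (z - p))"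
      have quad: "0 \<le> t * t * (norm x)\<^sup>2 + 2 * (t * r)" for t
      proof -
        have "d \<le> norm (z - (p - t *\<^sub>R x))"
          by (intro dle subspace_diff subspace_scale sub pM x)
        also have "z - (p - t *\<^sub>R x) = t *\<^sub>R x + (z - p)" by simp
        finally have "d\<^sup>2 \<le> (norm (t *\<^sub>R x + (z - p)))\<^sup>2"
          using d0 by (rule power_mono)
        then have "(norm (z - p))\<^sup>2 \<le> (norm (t *\<^sub>R x + (z - p)))\<^sup>2"
          using pd by linarith
        then show ?thesis
          unfolding power2_norm_add
          by (simp add: r_def cinner.scaleR_left power_mult_distrib flip: power2_eq_square)
      qed
      \<comment> \<open>The parabola in \<open>t\<close> has slope \<open>2 r\<close> at \<open>0\<close>; it is negative at \<open>t = - r / n\<close> unless \<open>r = 0\<close>.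
        The summand \<open>1\<close> keeps \<open>n\<close> positive for \<open>x = 0\<close>.\<close>
      define n where "n = (norm x)\<^sup>2 + 1"
      have n: "n > 0" by (simp add: n_def add_nonneg_pos)
      have "0 \<le> (- r / n) * (- r / n) * (n - 1) + 2 * ((- r / n) * r)"
        using quad[of "- r / n"] by (simp add: n_def)
      also have "\<dots> = - (r\<^sup>2 / n\<^sup>2) * (n + 1)"
        using n by (simp add: field_simps power2_eq_square)
      finally have "r\<^sup>2 / n\<^sup>2 * (n + 1) \<le> 0" by simp
      then show "r = 0" using n by (simp add: mult_le_0_iff divide_le_0_iff not_le)
    qed
    then have "z - p = 0" using orth by blast
    then show "z \<in> M" using pM by simp
  qed
  then show ?thesis by blast
qed

section \<open>Exponentials of bounded skew-symmetric operators\<close>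

interpretation blinfun_compose: bounded_bilinear "(o\<^sub>L)"
  by (rule bounded_bilinear_blinfun_compose)

lemma norm_increment_le:
  fixes f :: "real \<Rightarrow> 'b::real_normed_vector"
  assumes der: "\<And>s. (f has_vector_derivative f' s) (at s)"
    and K: "\<And>s. \<bar>s\<bar> \<le> \<bar>t\<bar> \<Longrightarrow> norm (f' s) \<le> K"
  shows "norm (f t - f 0) \<le> \<bar>t\<bar> * K"
proof -
  have "norm (f t - f 0) \<le> K * norm (t - 0)"
  proof (rule differentiable_bound[where S = "{- \<bar>t\<bar>..\<bar>t\<bar>}" and f' = "\<lambda>s h. h *\<^sub>R f' s"])
    show "(f has_derivative (\<lambda>h. h *\<^sub>R f' s)) (at s within {- \<bar>t\<bar>..\<bar>t\<bar>})" for s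
      using der[of s] has_derivative_at_withinI unfolding has_vector_derivative_def by blast
    show "onorm (\<lambda>h. h *\<^sub>R f' s) \<le> K" if "s \<in> {- \<bar>t\<bar>..\<bar>t\<bar>}" for s
    proof (rule onorm_le)
      have "norm (f' s) \<le> K" using that by (intro K) auto
      then show "norm (h *\<^sub>R f' s) \<le> K * norm h" for h
        using mult_left_mono[of _ _ "\<bar>h\<bar>"] by (simp add: mult.commute[of K])
    qed
  qed auto
  then show ?thesis by (simp add: mult.commute)
qed

text \<open>Orbits and matrix coefficients of a group are differentiated in this form: at any time \<open>t\<close> the
  quotient can be rewritten by the group law as one at time \<open>0\<close>.\<close>

lemma has_vector_derivative_iff_difference_quotient:
  fixes f :: "real \<Rightarrow> 'b::real_normed_vector"
  shows "(f has_vector_derivative d) (at t) \<longleftrightarrow> ((\<lambda>h. (1 / h) *\<^sub>R (f (t + h) - f t)) \<longlongrightarrow> d) (at 0)"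
proof -
  have "((\<lambda>h. (1 / h) *\<^sub>R (f (t + h) - f t)) \<longlongrightarrow> d) (at 0) \<longleftrightarrow>
      ((\<lambda>h. norm ((1 / h) *\<^sub>R (f (t + h) - f t) - d)) \<longlongrightarrow> 0) (at 0)"
    by (simp only: tendsto_norm_zero_iff LIM_zero_iff)
  also have "\<dots> \<longleftrightarrow> ((\<lambda>h. norm (f (t + h) - f t - h *\<^sub>R d) / norm h) \<longlongrightarrow> 0) (at 0)"
  proof (rule filterlim_cong[OF refl refl], unfold eventually_at_filter, intro always_eventually allI impI)
    fix h :: real assume h: "h \<noteq> 0"
    then have "(1 / h) *\<^sub>R (f (t + h) - f t) - d = (1 / h) *\<^sub>R (f (t + h) - f t - h *\<^sub>R d)"
      by (simp add: scaleR_diff_right)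
    then show "norm ((1 / h) *\<^sub>R (f (t + h) - f t) - d) = norm (f (t + h) - f t - h *\<^sub>R d) / norm h"
      by simp
  qed
  finally show ?thesis
    unfolding has_vector_derivative_def has_derivative_at by (simp add: bounded_linear_scaleR_left)
qed

text \<open>Conservation of energy: a curve whose velocity is orthogonal to its position stays on a
  sphere. Every uniqueness statement about evolution equations below rests on this.\<close>

lemma norm_constant_if_velocity_orthogonal:
  fixes u :: "real \<Rightarrow> 'a::complex_inner"
  assumes der: "\<And>t. (u has_vector_derivative u' t) (at t)"
    and orth: "\<And>t. Re (cinner (u' t) (u t)) = 0"
  shows "norm (u t) = norm (u 0)"
proof -
  have "((\<lambda>s. Re (cinner (u s) (u s))) has_vector_derivative
      Re (cinner (u s) (u' s) + cinner (u' s) (u s))) (at s)" for s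
    by (intro bounded_linear.has_vector_derivative[OF bounded_linear_Re]
        cinner.has_vector_derivative der)
  moreover have "Re (cinner (u s) (u' s)) = 0" for s
    using orth[of s] by (subst cinner_commute) simp
  ultimately have "((\<lambda>s. Re (cinner (u s) (u s))) has_real_derivative 0) (at s)" for s
    using orth by (simp add: has_real_derivative_iff_has_vector_derivative)
  then have "Re (cinner (u t) (u t)) = Re (cinner (u 0) (u 0))"
    by (intro DERIV_isconst_all) auto
  then show ?thesis by (simp add: norm_eq_sqrt_cinner)
qed

definition skew :: "('a::complex_inner \<Rightarrow>\<^sub>L 'a) \<Rightarrow> bool" where
  "skew B \<longleftrightarrow> (\<forall>x. Re (cinner (B x) x) = 0)"

lemma skew_evolution_unique:
  assumes "skew B" and "\<And>t. (u has_vector_derivative B (u t)) (at t)" and "u 0 = 0"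
  shows "u t = 0"
  using norm_constant_if_velocity_orthogonal[of u "\<lambda>t. B (u t)" t] assms by (simp add: skew_def)

text \<open>This is \<open>exp(t B)\<close>.  On the trivial space the identity has norm \<open>0\<close>, so bounded operators do not
  form a unital normed algebra in the sense of the type class on which \<open>exp\<close> is defined.\<close>

definition blinfun_exp :: "('a::banach \<Rightarrow>\<^sub>L 'a) \<Rightarrow> real \<Rightarrow> 'a \<Rightarrow>\<^sub>L 'a" where
  "blinfun_exp B t = (\<Sum>n. (t ^ n / fact n) *\<^sub>R (((o\<^sub>L) B ^^ n) id_blinfun))"

lemma blinfun_exp_0 [simp]: "blinfun_exp B 0 = id_blinfun"
proof -
  have "blinfun_exp B 0 = (\<Sum>n\<in>{0}. ((0::real) ^ n / fact n) *\<^sub>R (((o\<^sub>L) B ^^ n) id_blinfun))"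
    unfolding blinfun_exp_def by (rule suminf_finite) auto
  then show ?thesis by simp
qed

text \<open>The termwise derivative of the exponential series is the series composed with \<open>B\<close>,
  shifted by one index; both converge uniformly for bounded \<open>t\<close>.\<close>

lemma has_vector_derivative_blinfun_exp:
  "(blinfun_exp B has_vector_derivative B o\<^sub>L blinfun_exp B t) (at t)"
proof -
  define P where "P n = ((o\<^sub>L) B ^^ n) id_blinfun" for n
  define f where "f n t = (t ^ n / fact n) *\<^sub>R P n" for n and t :: real
  define f' where "f' n t = (of_nat n * t ^ (n - 1) / fact n) *\<^sub>R P n" for n and t :: real
  define r where "r = \<bar>t\<bar> + 1"
  define I where "I = {- r<..<r}"
  have E: "blinfun_exp B = (\<lambda>t. \<Sum>n. f n t)"
    by (simp add: blinfun_exp_def f_def P_def fun_eq_iff)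
  have normP: "norm (P n) \<le> norm B ^ n" for n
  proof (induction n)
    case 0
    then show ?case by (simp add: P_def norm_blinfun_id_le)
  next
    case (Suc n)
    have "norm (P (Suc n)) \<le> norm B * norm (P n)"
      by (simp add: P_def norm_blinfun_compose)
    also have "\<dots> \<le> norm B * norm B ^ n" using Suc by (intro mult_left_mono) auto
    finally show ?case by simp
  qed
  have ul: "uniform_limit I (\<lambda>n s. \<Sum>i<n. f i s) (blinfun_exp B) sequentially"
    unfolding E
  proof (rule Weierstrass_m_test[where M = "\<lambda>n. (r * norm B) ^ n / fact n"])
    show "norm (f n s) \<le> (r * norm B) ^ n / fact n" if "s \<in> I" for n s
    proof -
      have "\<bar>s\<bar> ^ n \<le> r ^ n" using that by (intro power_mono) (auto simp: I_def)
      then have "\<bar>s\<bar> ^ n * norm (P n) \<le> r ^ n * norm B ^ n"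
        by (intro mult_mono normP) (auto simp: r_def)
      then show ?thesis
        by (simp add: f_def power_abs power_mult_distrib divide_right_mono)
    qed
    show "summable (\<lambda>n. (r * norm B) ^ n / fact n)"
      using summable_exp[of "r * norm B"] by (simp add: divide_inverse mult.commute)
  qed
  have step: "f' (Suc i) s = B o\<^sub>L f i s" for i s
    by (simp add: f'_def f_def P_def blinfun_compose.scaleR_right)
  have shift: "(\<Sum>i<Suc n. f' i s) = B o\<^sub>L (\<Sum>i<n. f i s)" for n s
  proof -
    have "(\<Sum>i<Suc n. f' i s) = (\<Sum>i<n. f' (Suc i) s)"
      by (subst sum.lessThan_Suc_shift) (simp add: f'_def)
    also have "\<dots> = B o\<^sub>L (\<Sum>i<n. f i s)"
      by (simp add: step blinfun_compose.sum_right)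
    finally show ?thesis .
  qed
  have "\<exists>G. \<forall>s\<in>I. (\<lambda>n. f n s) sums G s \<and>
      (G has_derivative (\<lambda>h. h *\<^sub>R (B o\<^sub>L blinfun_exp B s))) (at s within I)"
  proof (rule has_derivative_series[where f' = "\<lambda>n s h. h *\<^sub>R f' n s" and x = 0])
    show "(f n has_derivative (\<lambda>h. h *\<^sub>R f' n s)) (at s within I)" for n s
      unfolding has_vector_derivative_def[symmetric] f_def f'_def
      by (auto intro!: derivative_eq_intros)
    show "\<forall>\<^sub>F n in sequentially. \<forall>s\<in>I. \<forall>h.
        norm ((\<Sum>i<n. h *\<^sub>R f' i s) - h *\<^sub>R (B o\<^sub>L blinfun_exp B s)) \<le> e * norm h"
      if e: "e > 0" for e
    proof (subst eventually_sequentially_Suc[symmetric])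
      have n1: "norm B + 1 > 0" by (simp add: add_nonneg_pos)
      then have "e / (norm B + 1) > 0" using e by simp
      from uniform_limitD[OF ul this]
      show "\<forall>\<^sub>F n in sequentially. \<forall>s\<in>I. \<forall>h.
          norm ((\<Sum>i<Suc n. h *\<^sub>R f' i s) - h *\<^sub>R (B o\<^sub>L blinfun_exp B s)) \<le> e * norm h"
      proof (eventually_elim, intro ballI allI)
        fix n s h
        assume "\<forall>s\<in>I. dist (\<Sum>i<n. f i s) (blinfun_exp B s) < e / (norm B + 1)" and "s \<in> I"
        then have d: "norm ((\<Sum>i<n. f i s) - blinfun_exp B s) < e / (norm B + 1)"
          by (simp add: dist_norm)
        have "norm ((\<Sum>i<Suc n. f' i s) - (B o\<^sub>L blinfun_exp B s)) =
            norm (B o\<^sub>L ((\<Sum>i<n. f i s) - blinfun_exp B s))"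
          by (simp only: shift blinfun_compose.diff_right)
        also have "\<dots> \<le> norm B * norm ((\<Sum>i<n. f i s) - blinfun_exp B s)"
          by (rule norm_blinfun_compose)
        also have "\<dots> \<le> norm B * (e / (norm B + 1))"
          using d by (intro mult_left_mono) auto
        also have "\<dots> \<le> e" using e n1 by (simp add: field_simps)
        finally have "\<bar>h\<bar> * norm ((\<Sum>i<Suc n. f' i s) - (B o\<^sub>L blinfun_exp B s)) \<le> \<bar>h\<bar> * e"
          by (intro mult_left_mono) auto
        then show "norm ((\<Sum>i<Suc n. h *\<^sub>R f' i s) - h *\<^sub>R (B o\<^sub>L blinfun_exp B s)) \<le> e * norm h"
          by (simp only: scaleR_right.sum[symmetric] scaleR_diff_right[symmetric] norm_scaleR
              real_norm_def mult.commute[of e])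
      qed
    qed
    show "(\<lambda>n. f n 0) sums f 0 0"
      using sums_single[of 0 "\<lambda>n. f n 0"]
      by (rule sums_cong[THEN iffD1, rotated]) (auto simp: f_def)
  qed (auto simp: I_def r_def)
  then obtain G where G: "\<And>s. s \<in> I \<Longrightarrow> (\<lambda>n. f n s) sums G s"
    "\<And>s. s \<in> I \<Longrightarrow> (G has_derivative (\<lambda>h. h *\<^sub>R (B o\<^sub>L blinfun_exp B s))) (at s within I)"
    by blast
  have tI: "t \<in> I" and oI: "open I" by (auto simp: I_def r_def)
  have "G s = blinfun_exp B s" if "s \<in> I" for s
    using G(1)[OF that] by (simp add: E sums_unique)
  moreover have "(G has_derivative (\<lambda>h. h *\<^sub>R (B o\<^sub>L blinfun_exp B t))) (at t)"
    using G(2)[OF tI] tI oI at_within_open by metis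
  ultimately show ?thesis
    unfolding has_vector_derivative_def
    by (rule has_derivative_transform_within_open[OF _ oI tI, rotated])
qed

lemma has_vector_derivative_blinfun_exp_apply:
  "((\<lambda>t. blinfun_exp B t x) has_vector_derivative B (blinfun_exp B t x)) (at t)"
  using bounded_linear.has_vector_derivative[OF blinfun.bounded_linear_left
      has_vector_derivative_blinfun_exp[of B t], of x]
  by simp

lemma norm_blinfun_exp_apply:
  fixes x :: "'a::chilbert_space"
  assumes "skew B"
  shows "norm (blinfun_exp B t x) = norm x"
  using norm_constant_if_velocity_orthogonal[OF has_vector_derivative_blinfun_exp_apply, of B x t]
    assms by (simp add: skew_def)

text \<open>Both sides solve the evolution equation of \<open>B\<close> with initial value \<open>C x\<close>.\<close>

lemma blinfun_exp_commute:
  fixes B :: "'a::chilbert_space \<Rightarrow>\<^sub>L 'a"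
  assumes B: "skew B" and comm: "\<And>y. C (B y) = B (C y)" and C: "bounded_linear C"
  shows "C (blinfun_exp B t x) = blinfun_exp B t (C x)"
proof -
  have "C (blinfun_exp B t x) - blinfun_exp B t (C x) = 0"
  proof (rule skew_evolution_unique[OF B, of "\<lambda>t. C (blinfun_exp B t x) - blinfun_exp B t (C x)"])
    fix t
    have "((\<lambda>t. C (blinfun_exp B t x) - blinfun_exp B t (C x)) has_vector_derivative
        C (B (blinfun_exp B t x)) - B (blinfun_exp B t (C x))) (at t)"
      by (intro has_vector_derivative_diff has_vector_derivative_blinfun_exp_apply
          bounded_linear.has_vector_derivative[OF C])
    then show "((\<lambda>t. C (blinfun_exp B t x) - blinfun_exp B t (C x)) has_vector_derivative
        B (C (blinfun_exp B t x) - blinfun_exp B t (C x))) (at t)"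
      by (simp add: comm blinfun.diff_right)
  qed simp
  then show ?thesis by simp
qed

lemma blinfun_exp_add:
  fixes B :: "'a::chilbert_space \<Rightarrow>\<^sub>L 'a"
  assumes B: "skew B"
  shows "blinfun_exp B (s + t) x = blinfun_exp B s (blinfun_exp B t x)"
proof -
  have "blinfun_exp B (s + t) x - blinfun_exp B s (blinfun_exp B t x) = 0"
  proof (rule skew_evolution_unique[OF B, of "\<lambda>s. blinfun_exp B (s + t) x - blinfun_exp B s (blinfun_exp B t x)"])
    fix s
    have "((\<lambda>s. blinfun_exp B (s + t) x) has_vector_derivative B (blinfun_exp B (s + t) x)) (at s)"
    proof -
      have "((\<lambda>s. s + t) has_vector_derivative 1) (at s)"
        by (auto intro!: derivative_eq_intros)
      from vector_diff_chain_at[OF this has_vector_derivative_blinfun_exp_apply]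
      show ?thesis by (simp add: o_def)
    qed
    then show "((\<lambda>s. blinfun_exp B (s + t) x - blinfun_exp B s (blinfun_exp B t x)) has_vector_derivative
        B (blinfun_exp B (s + t) x - blinfun_exp B s (blinfun_exp B t x))) (at s)"
      unfolding blinfun.diff_right
      by (intro has_vector_derivative_diff has_vector_derivative_blinfun_exp_apply)
  qed simp
  then show ?thesis by simp
qed

lemma norm_blinfun_exp_minus_id_le:
  fixes B :: "'a::chilbert_space \<Rightarrow>\<^sub>L 'a"
  assumes B: "skew B"
  shows "norm (blinfun_exp B t x - x) \<le> \<bar>t\<bar> * norm (B x)"
proof -
  have "B (blinfun_exp B s x) = blinfun_exp B s (B x)" for s
    by (rule blinfun_exp_commute[OF B _ blinfun.bounded_linear_right]) simp
  then have "norm (B (blinfun_exp B s x)) \<le> norm (B x)" for s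
    by (simp add: norm_blinfun_exp_apply B)
  from norm_increment_le[OF has_vector_derivative_blinfun_exp_apply this]
  show ?thesis by simp
qed

text \<open>The curve \<open>exp(s B) exp((t - s) C) x\<close> joins \<open>exp(t C) x\<close> to \<open>exp(t B) x\<close>, and by commutation its
  velocity is an isometric image of \<open>(B - C) x\<close>.\<close>

lemma norm_blinfun_exp_diff_le:
  fixes B C :: "'a::chilbert_space \<Rightarrow>\<^sub>L 'a"
  assumes B: "skew B" and C: "skew C" and comm: "\<And>y. B (C y) = C (B y)"
  shows "norm (blinfun_exp B t x - blinfun_exp C t x) \<le> \<bar>t\<bar> * norm (B x - C x)"
proof -
  define \<phi> where "\<phi> s = blinfun_exp B s (blinfun_exp C (t - s) x)" for s
  have CB: "(B - C) (blinfun_exp C s y) = blinfun_exp C s ((B - C) y)" for s y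
    by (rule blinfun_exp_commute[OF C _ blinfun.bounded_linear_right])
      (simp add: blinfun.bilinear_simps comm)
  have BB: "B (blinfun_exp B s y) = blinfun_exp B s (B y)" for s y
    by (rule blinfun_exp_commute[OF B _ blinfun.bounded_linear_right]) simp
  have d: "((\<lambda>s. blinfun_exp C (t - s) x) has_vector_derivative - C (blinfun_exp C (t - s) x)) (at s)" for s
  proof -
    have "((\<lambda>s. t - s) has_vector_derivative - 1) (at s)"
      by (auto intro!: derivative_eq_intros)
    from vector_diff_chain_at[OF this has_vector_derivative_blinfun_exp_apply]
    show ?thesis by (simp add: o_def)
  qed
  have "(\<phi> has_vector_derivative blinfun_exp B s (- C (blinfun_exp C (t - s) x))
      + (B o\<^sub>L blinfun_exp B s) (blinfun_exp C (t - s) x)) (at s)" for s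
    unfolding \<phi>_def
    by (intro blinfun.has_vector_derivative has_vector_derivative_blinfun_exp d)
  moreover have "blinfun_exp B s (- C (blinfun_exp C (t - s) x))
      + (B o\<^sub>L blinfun_exp B s) (blinfun_exp C (t - s) x) =
      blinfun_exp B s (blinfun_exp C (t - s) ((B - C) x))" for s
    by (simp add: BB CB[symmetric]) (simp add: blinfun.bilinear_simps)
  ultimately have "(\<phi> has_vector_derivative blinfun_exp B s (blinfun_exp C (t - s) ((B - C) x))) (at s)" for s
    by simp
  then have "norm (\<phi> t - \<phi> 0) \<le> \<bar>t\<bar> * norm ((B - C) x)"
    by (rule norm_increment_le) (simp add: norm_blinfun_exp_apply B C)
  then show ?thesis by (simp add: \<phi>_def blinfun.diff_left)
qed

lemma norm_blinfun_exp_linearization_le: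
  fixes B :: "'a::chilbert_space \<Rightarrow>\<^sub>L 'a"
  assumes B: "skew B" and \<delta>: "\<And>s. \<bar>s\<bar> \<le> \<bar>t\<bar> \<Longrightarrow> norm (blinfun_exp B s (B x) - B x) \<le> \<delta>"
  shows "norm (blinfun_exp B t x - x - t *\<^sub>R B x) \<le> \<bar>t\<bar> * \<delta>"
proof -
  have BB: "B (blinfun_exp B s x) = blinfun_exp B s (B x)" for s
    by (rule blinfun_exp_commute[OF B _ blinfun.bounded_linear_right]) simp
  have "((\<lambda>s. blinfun_exp B s x - s *\<^sub>R B x) has_vector_derivative
     blinfun_exp B s (B x) - B x) (at s)" for s
    using has_vector_derivative_blinfun_exp_apply[of B x s]
    by (auto simp: BB intro!: derivative_eq_intros)
  from norm_increment_le[OF this \<delta>] show ?thesis by (simp add: algebra_simps)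
qed

section \<open>Resolvents of skew-adjoint operators\<close>

text \<open>The operator \<open>A = iD\<close> with domain \<open>S\<close>.  The last two assumptions say that the adjoint of
  \<open>A\<close> contains \<open>- A\<close> and is contained in it.\<close>

locale skew_adjoint =
  fixes S :: "'a::chilbert_space set" and A :: "'a \<Rightarrow> 'a"
  assumes zero_mem: "0 \<in> S"
    and add_mem: "x \<in> S \<Longrightarrow> y \<in> S \<Longrightarrow> x + y \<in> S"
    and A_add: "x \<in> S \<Longrightarrow> y \<in> S \<Longrightarrow> A (x + y) = A x + A y"
    and scaleC_mem: "x \<in> S \<Longrightarrow> c *\<^sub>C x \<in> S"
    and A_scaleC: "x \<in> S \<Longrightarrow> A (c *\<^sub>C x) = c *\<^sub>C A x"
    and dense: "closure S = UNIV"
    and skew_symmetric: "x \<in> S \<Longrightarrow> y \<in> S \<Longrightarrow> cinner (A x) y = - cinner x (A y)"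
    and adjoint_subset: "(\<And>x. x \<in> S \<Longrightarrow> cinner (A x) y = - cinner x z) \<Longrightarrow> y \<in> S \<and> A y = z"
begin

lemma scaleR_mem: "x \<in> S \<Longrightarrow> r *\<^sub>R x \<in> S"
  by (metis scaleC_mem scaleC_of_real)

lemma A_scaleR: "x \<in> S \<Longrightarrow> A (r *\<^sub>R x) = r *\<^sub>R A x"
  by (metis A_scaleC scaleC_of_real)

lemma diff_mem: "x \<in> S \<Longrightarrow> y \<in> S \<Longrightarrow> x - y \<in> S"
  using add_mem[of x "-1 *\<^sub>R y"] scaleR_mem[of y "-1"] by simp

lemma A_diff: "x \<in> S \<Longrightarrow> y \<in> S \<Longrightarrow> A (x - y) = A x - A y"
  using A_add[of x "-1 *\<^sub>R y"] scaleR_mem[of y "-1"] A_scaleR[of y "-1"] by simp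

lemma Re_cinner_A: assumes "x \<in> S" shows "Re (cinner (A x) x) = 0"
proof -
  have "Re (cinner (A x) x) = - Re (cinner x (A x))"
    using skew_symmetric[OF assms assms] by simp
  moreover have "Re (cinner x (A x)) = Re (cinner (A x) x)" by (subst cinner_commute) simp
  ultimately show ?thesis by simp
qed

lemma dense_approx:
  assumes "e > 0" obtains y where "y \<in> S" "norm (x - y) < e"
  using dense closure_approachable[of x S] assms by (metis UNIV_I dist_norm norm_minus_commute)

text \<open>Since \<open>x\<close> and \<open>A x\<close> are orthogonal for the real part of the inner product, Pythagoras applies to
  \<open>l x - A x\<close>.\<close>

lemma norm_le_norm_shifted:
  assumes "x \<in> S" shows "\<bar>l\<bar> * norm x \<le> norm (l *\<^sub>R x - A x)"
proof -
  have "Re (cinner x (A x)) = 0" using Re_cinner_A[OF assms] by (subst cinner_commute) simp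
  then have "(norm (l *\<^sub>R x - A x))\<^sup>2 = (norm (l *\<^sub>R x))\<^sup>2 + (norm (A x))\<^sup>2"
    using power2_norm_add[of "l *\<^sub>R x" "- A x"] by (simp add: cinner.minus_right cinner.scaleR_left)
  then have "(norm (l *\<^sub>R x))\<^sup>2 \<le> (norm (l *\<^sub>R x - A x))\<^sup>2" by simp
  then show ?thesis using power2_le_imp_le by fastforce
qed

text \<open>The range is closed by the lower bound for \<open>l - A\<close> and by the
  closedness of \<open>A\<close>, which every operator equal to minus its adjoint has; a vector
  orthogonal to it is an eigenvector of the adjoint \<open>- A\<close> for the nonzero real eigenvalue \<open>l\<close>,
  hence vanishes.\<close>

lemma range_eq_UNIV:
  assumes l: "l \<noteq> 0"
  shows "(\<lambda>x. l *\<^sub>R x - A x) ` S = UNIV"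
proof (rule closed_subspace_eq_UNIV)
  let ?T = "\<lambda>x. l *\<^sub>R x - A x"
  show "subspace (?T ` S)"
  proof (rule subspaceI)
    show "0 \<in> ?T ` S" using zero_mem A_scaleR[of 0 0] by (force intro!: image_eqI[of _ _ 0])
    fix a b assume "a \<in> ?T ` S" "b \<in> ?T ` S"
    then obtain x y where xy: "x \<in> S" "y \<in> S" "a = ?T x" "b = ?T y" by blast
    then show "a + b \<in> ?T ` S"
      by (intro image_eqI[of _ _ "x + y"]) (auto simp: A_add add_mem algebra_simps)
    show "r *\<^sub>R a \<in> ?T ` S" for r
      using xy by (intro image_eqI[of _ _ "r *\<^sub>R x"]) (auto simp: A_scaleR scaleR_mem scaleR_diff_right mult.commute)
  qed
  show "closed (?T ` S)"
  proof (unfold closed_sequential_limits, intro allI impI, elim conjE)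
    fix f y assume "\<forall>n. f n \<in> ?T ` S" and fy: "f \<longlonglongrightarrow> y"
    then have "\<forall>n. \<exists>x. x \<in> S \<and> f n = ?T x" by blast
    then obtain x where xS: "\<And>n. x n \<in> S" and fx: "\<And>n. f n = ?T (x n)" by metis
    have "Cauchy x"
    proof (rule metric_CauchyI)
      fix e :: real assume "e > 0"
      then have "\<bar>l\<bar> * e > 0" using l by simp
      then obtain M where M: "\<And>m n. m \<ge> M \<Longrightarrow> n \<ge> M \<Longrightarrow> dist (f m) (f n) < \<bar>l\<bar> * e"
        using metric_CauchyD[OF LIMSEQ_imp_Cauchy[OF fy]] by metis
      have "dist (x m) (x n) < e" if "m \<ge> M" "n \<ge> M" for m n
      proof -
        have "\<bar>l\<bar> * norm (x m - x n) \<le> norm (f m - f n)"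
          using norm_le_norm_shifted[OF diff_mem[OF xS xS], of l m n]
          by (simp add: fx A_diff xS algebra_simps)
        also have "\<dots> < \<bar>l\<bar> * e" using M[OF that] by (simp add: dist_norm)
        finally show ?thesis using l by (simp add: dist_norm)
      qed
      then show "\<exists>M. \<forall>m\<ge>M. \<forall>n\<ge>M. dist (x m) (x n) < e" by blast
    qed
    then obtain p where p: "x \<longlonglongrightarrow> p" using Cauchy_convergent convergentD by blast
    have Ax: "(\<lambda>n. A (x n)) \<longlonglongrightarrow> l *\<^sub>R p - y"
      using tendsto_diff[OF tendsto_scaleR[OF tendsto_const[of l] p] fy] by (simp add: fx)
    have "p \<in> S \<and> A p = l *\<^sub>R p - y"
    proof (rule adjoint_subset)
      fix w assume w: "w \<in> S"
      have "(\<lambda>n. cinner (A w) (x n)) \<longlonglongrightarrow> cinner (A w) p"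
        by (intro cinner.tendsto tendsto_const p)
      moreover have "(\<lambda>n. cinner (A w) (x n)) \<longlonglongrightarrow> - cinner w (l *\<^sub>R p - y)"
        unfolding skew_symmetric[OF w xS]
        by (intro cinner.tendsto tendsto_minus tendsto_const Ax)
      ultimately show "cinner (A w) p = - cinner w (l *\<^sub>R p - y)" by (rule LIMSEQ_unique)
    qed
    then show "y \<in> ?T ` S" by (intro image_eqI[of _ _ p]) auto
  qed
  fix y assume orth: "\<forall>x\<in>?T ` S. Re (cinner x y) = 0"
  have re: "Re (cinner (A x) y) = l * Re (cinner x y)" if "x \<in> S" for x
    using orth that by (auto simp: cinner.diff_left cinner.scaleR_left)
  have "y \<in> S \<and> A y = - (l *\<^sub>R y)"
  proof (rule adjoint_subset)
    fix x assume x: "x \<in> S"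
    \<comment> \<open>The domain is a complex subspace, so orthogonality for the real part passes to \<open>\<i> x\<close>.\<close>
    have "Im (cinner (A x) y) = l * Im (cinner x y)"
      using re[OF scaleC_mem[OF x, of \<i>]] by (simp add: A_scaleC x cinner_scaleC_left)
    then show "cinner (A x) y = - cinner x (- (l *\<^sub>R y))"
      using re[OF x] by (simp add: complex_eq_iff cinner.minus_right cinner.scaleR_right)
  qed
  then have "l * Re (cinner y y) = 0"
    using re[of y] Re_cinner_A[of y] by simp
  then show "y = 0" using l norm_eq_sqrt_cinner[of y] by simp
qed

definition resolvent :: "real \<Rightarrow> 'a \<Rightarrow>\<^sub>L 'a" where
  "resolvent l = Blinfun (inv_into S (\<lambda>x. l *\<^sub>R x - A x))"

lemma
  assumes l: "l \<noteq> 0"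
  shows resolvent_mem: "resolvent l y \<in> S"
    and resolvent_right: "l *\<^sub>R resolvent l y - A (resolvent l y) = y"
    and norm_resolvent_le: "\<bar>l\<bar> * norm (resolvent l y) \<le> norm y"
    and resolvent_left: "x \<in> S \<Longrightarrow> resolvent l (l *\<^sub>R x - A x) = x"
proof -
  let ?T = "\<lambda>x. l *\<^sub>R x - A x"
  let ?R = "inv_into S ?T"
  have mem: "?R y \<in> S" for y using range_eq_UNIV[OF l] by (intro inv_into_into) auto
  have right: "?T (?R y) = y" for y using range_eq_UNIV[OF l] by (intro f_inv_into_f) auto
  have inj: "inj_on ?T S"
  proof (rule inj_onI)
    fix x y assume "x \<in> S" "y \<in> S" "?T x = ?T y"
    then have "\<bar>l\<bar> * norm (x - y) \<le> 0"
      using norm_le_norm_shifted[OF diff_mem[of x y], of l] by (simp add: A_diff algebra_simps)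
    then show "x = y" using l by (simp add: mult_le_0_iff)
  qed
  have left: "?R (?T x) = x" if "x \<in> S" for x by (rule inv_into_f_f[OF inj that])
  have bl: "bounded_linear ?R"
  proof (rule bounded_linear_intro)
    fix x y r
    have "?T (?R x + ?R y) = x + y"
      using right[of x] right[of y] by (simp add: A_add mem algebra_simps)
    then show "?R (x + y) = ?R x + ?R y" using left[OF add_mem[OF mem mem, of x y]] by simp
    have "?T (r *\<^sub>R ?R x) = r *\<^sub>R (?T (?R x))" by (simp add: A_scaleR mem algebra_simps)
    then have "?T (r *\<^sub>R ?R x) = r *\<^sub>R x" by (simp only: right)
    then show "?R (r *\<^sub>R x) = r *\<^sub>R ?R x" using left[OF scaleR_mem[OF mem, of r x]] by simp
    show "norm (?R x) \<le> norm x * (1 / \<bar>l\<bar>)"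
      using norm_le_norm_shifted[OF mem, of l x] l by (simp add: right field_simps)
  qed
  have R: "blinfun_apply (resolvent l) = ?R"
    unfolding resolvent_def by (rule bounded_linear_Blinfun_apply[OF bl])
  show "resolvent l y \<in> S" "l *\<^sub>R resolvent l y - A (resolvent l y) = y"
    using mem[of y] right[of y] by (simp_all only: R)
  show "\<bar>l\<bar> * norm (resolvent l y) \<le> norm y"
    using norm_le_norm_shifted[OF mem, of l y] by (simp only: R right)
  show "resolvent l (l *\<^sub>R x - A x) = x" if "x \<in> S"
    using left[OF that] by (simp only: R)
qed

lemma resolvent_eqI:
  assumes "l \<noteq> 0" "x \<in> S" "l *\<^sub>R x - A x = y" shows "resolvent l y = x"
  using resolvent_left assms by blast

lemma resolvent_scaleC:
  assumes l: "l \<noteq> 0" shows "resolvent l (c *\<^sub>C y) = c *\<^sub>C resolvent l y"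
proof (rule resolvent_eqI[OF l scaleC_mem[OF resolvent_mem[OF l]]])
  have "l *\<^sub>R (c *\<^sub>C x) - c *\<^sub>C z = c *\<^sub>C (l *\<^sub>R x - z)" for x z :: 'a
    by (simp add: linear_simps[OF bounded_linear_scaleC])
  then show "l *\<^sub>R c *\<^sub>C resolvent l y - A (c *\<^sub>C resolvent l y) = c *\<^sub>C y"
    using resolvent_right[OF l, of y] by (simp add: A_scaleC resolvent_mem l)
qed

text \<open>With \<open>u\<close> the left-hand side, \<open>A u\<close> lies in the domain, and on such vectors \<open>l - A\<close> and \<open>m - A\<close>
  commute, being polynomials in \<open>A\<close>; so \<open>(m - A) u\<close> is the resolvent of \<open>x\<close> at \<open>l\<close>.\<close>

lemma resolvent_commute:
  assumes l: "l \<noteq> 0" and m: "m \<noteq> 0"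
  shows "resolvent l (resolvent m x) = resolvent m (resolvent l x)"
proof -
  define u where "u = resolvent l (resolvent m x)"
  define v where "v = resolvent m x"
  have uS: "u \<in> S" and vS: "v \<in> S" by (simp_all add: u_def v_def resolvent_mem l m)
  have u: "l *\<^sub>R u - A u = v" and v: "m *\<^sub>R v - A v = x"
    unfolding u_def v_def by (rule resolvent_right[OF l] resolvent_right[OF m])+
  have mu: "m *\<^sub>R u - A u = v + (m - l) *\<^sub>R u" using u by (simp add: algebra_simps)
  have "resolvent l x = v + (m - l) *\<^sub>R u"
  proof (rule resolvent_eqI[OF l add_mem[OF vS scaleR_mem[OF uS]]])
    have "l *\<^sub>R (v + (m - l) *\<^sub>R u) - A (v + (m - l) *\<^sub>R u) = l *\<^sub>R v - A v + (m - l) *\<^sub>R (l *\<^sub>R u - A u)"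
      by (simp add: A_add A_scaleR uS vS scaleR_mem) (simp add: algebra_simps)
    also have "\<dots> = m *\<^sub>R v - A v" by (simp only: u) (simp add: algebra_simps)
    finally show "l *\<^sub>R (v + (m - l) *\<^sub>R u) - A (v + (m - l) *\<^sub>R u) = x" using v by simp
  qed
  then have "resolvent m (resolvent l x) = u"
    using resolvent_eqI[OF m uS] mu by simp
  then show ?thesis by (simp add: u_def)
qed

lemma cinner_resolvent:
  assumes l: "l \<noteq> 0"
  shows "cinner (resolvent l x) y = - cinner x (resolvent (- l) y)"
proof -
  define u where "u = resolvent l x"
  define v where "v = resolvent (- l) y"
  have uS: "u \<in> S" and vS: "v \<in> S" by (simp_all add: u_def v_def resolvent_mem l)
  have x: "x = l *\<^sub>R u - A u" and y: "y = (- l) *\<^sub>R v - A v"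
    unfolding u_def v_def using resolvent_right[of l] resolvent_right[of "-l"] l by simp_all
  have "cinner u y = - cinner x v"
    unfolding x y using skew_symmetric[OF uS vS]
    by (simp add: cinner.diff_left cinner.diff_right cinner.minus_right cinner.scaleR_left cinner.scaleR_right)
  then show ?thesis by (simp add: u_def v_def)
qed

lemma resolvent_A:
  assumes "l \<noteq> 0" "x \<in> S" shows "resolvent l (A x) = l *\<^sub>R resolvent l x - x"
  using resolvent_left[OF assms] by (simp add: blinfun.diff_right blinfun.scaleR_right algebra_simps)

text \<open>As \<open>\<bar>l\<bar>\<close> grows, \<open>l (l - A)\<^sup>-\<^sup>1\<close> tends strongly to the identity: on the domain the difference is
  \<open>(l - A)\<^sup>-\<^sup>1 A\<close>, of order \<open>1 / l\<close>, and a vector \<open>z\<close> of the domain near \<open>y\<close> costs an arbitrarily small \<open>e\<close>.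
  Allowing both signs of \<open>l\<close> treats \<open>A\<close> and \<open>- A\<close> together.\<close>

lemma scaled_resolvent_near_id:
  assumes e: "e > 0"
  obtains K where "\<And>l. l \<noteq> 0 \<Longrightarrow> norm (l *\<^sub>R resolvent l y - y) \<le> e + K / \<bar>l\<bar>"
proof -
  obtain z where z: "z \<in> S" "norm (y - z) < e / 2" using dense_approx[of "e / 2" y] e by auto
  show ?thesis
  proof (rule that[of "norm (A z)"])
    fix l :: real assume l: "l \<noteq> 0"
    have 1: "norm (l *\<^sub>R resolvent l (y - z)) \<le> norm (y - z)"
      using norm_resolvent_le[OF l] by simp
    have 2: "norm (l *\<^sub>R resolvent l z - z) \<le> norm (A z) / \<bar>l\<bar>"
      using norm_resolvent_le[OF l, of "A z"] l z(1) by (simp add: resolvent_A field_simps)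
    have "l *\<^sub>R resolvent l y - y = l *\<^sub>R resolvent l (y - z) + (l *\<^sub>R resolvent l z - z) - (y - z)"
      by (simp add: blinfun.diff_right algebra_simps)
    also have "norm \<dots> \<le> norm (l *\<^sub>R resolvent l (y - z)) + norm (l *\<^sub>R resolvent l z - z) + norm (y - z)"
      by (meson norm_triangle_le_diff norm_triangle_ineq add_right_mono order_trans)
    finally show "norm (l *\<^sub>R resolvent l y - y) \<le> e + norm (A z) / \<bar>l\<bar>"
      using 1 2 z(2) by linarith
  qed
qed

text \<open>By partial fractions this is \<open>l\<^sup>2 A (l\<^sup>2 - A\<^sup>2)\<^sup>-\<^sup>1\<close>.  The usual Yosida approximation \<open>l A (l - A)\<^sup>-\<^sup>1\<close>
  only generates contractions; this symmetric variant is skew, so it generates isometries.\<close>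

definition yosida :: "real \<Rightarrow> 'a \<Rightarrow>\<^sub>L 'a" where
  "yosida l = (l\<^sup>2 / 2) *\<^sub>R (resolvent l + resolvent (- l))"

lemma yosida_apply: "yosida l x = (l\<^sup>2 / 2) *\<^sub>R (resolvent l x + resolvent (- l) x)"
  by (simp add: yosida_def blinfun.scaleR_left blinfun.add_left)

lemma skew_yosida:
  assumes l: "l \<noteq> 0" shows "skew (yosida l)"
proof -
  have "Re (cinner (resolvent l x) x) = - Re (cinner (resolvent (- l) x) x)" for x
    unfolding cinner_resolvent[OF l] by (subst cinner_commute) simp
  then show ?thesis by (simp add: skew_def yosida_apply cinner.scaleR_left cinner.add_left)
qed

lemma yosida_commute:
  assumes "l \<noteq> 0" "m \<noteq> 0" shows "yosida l (yosida m x) = yosida m (yosida l x)"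
  using assms
  by (simp add: yosida_apply blinfun.scaleR_right blinfun.add_right resolvent_commute[of l] resolvent_commute[of "-l"])
    (simp add: algebra_simps)

lemma yosida_scaleC:
  assumes "l \<noteq> 0" shows "yosida l (c *\<^sub>C x) = c *\<^sub>C yosida l x"
  using assms by (simp add: yosida_apply resolvent_scaleC linear_simps[OF bounded_linear_scaleC])

text \<open>On the domain, the approximation is \<open>A x\<close> under the average of two contractions that tend
  strongly to the identity; hence it is bounded by \<open>norm (A x)\<close> and tends to \<open>A x\<close> as \<open>l\<close> grows.\<close>

lemma yosida_on_domain:
  assumes l: "l \<noteq> 0" and x: "x \<in> S"
  shows "yosida l x = (1 / 2) *\<^sub>R (l *\<^sub>R resolvent l (A x) + (- l) *\<^sub>R resolvent (- l) (A x))"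
  using l x by (simp add: yosida_apply resolvent_A power2_eq_square algebra_simps)

lemma norm_yosida_le:
  assumes l: "l \<noteq> 0" and x: "x \<in> S"
  shows "norm (yosida l x) \<le> norm (A x)"
proof -
  have "norm (l *\<^sub>R resolvent l (A x) + (- l) *\<^sub>R resolvent (- l) (A x)) \<le> norm (A x) + norm (A x)"
    using norm_resolvent_le[of l "A x"] norm_resolvent_le[of "- l" "A x"] l
    by (intro norm_triangle_le) auto
  then show ?thesis by (simp add: yosida_on_domain l x)
qed

lemma yosida_tendsto:
  assumes x: "x \<in> S"
  shows "(\<lambda>n. yosida (real (Suc n)) x) \<longlonglongrightarrow> A x"
proof (rule LIMSEQ_I)
  fix e :: real assume e: "e > 0"
  obtain K where K: "\<And>l. l \<noteq> 0 \<Longrightarrow> norm (l *\<^sub>R resolvent l (A x) - A x) \<le> e / 2 + K / \<bar>l\<bar>"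
    using scaled_resolvent_near_id[of "e / 2" "A x"] e by auto
  obtain N where N: "2 * K / e < real N" using reals_Archimedean2 by blast
  have "norm (yosida (real (Suc n)) x - A x) < e" if n: "n \<ge> N" for n
  proof -
    define l where "l = real (Suc n)"
    have l: "l > 0" by (simp add: l_def)
    have eq: "yosida l x - A x = (1 / 2) *\<^sub>R ((l *\<^sub>R resolvent l (A x) - A x) + ((- l) *\<^sub>R resolvent (- l) (A x) - A x))"
      using l by (simp add: yosida_on_domain x algebra_simps scaleR_2[symmetric])
    have "norm ((l *\<^sub>R resolvent l (A x) - A x) + ((- l) *\<^sub>R resolvent (- l) (A x) - A x)) \<le>
        (e / 2 + K / l) + (e / 2 + K / l)"
      using K[of l] K[of "- l"] l by (intro norm_triangle_mono) simp_all
    then have "norm (yosida l x - A x) \<le> e / 2 + K / l"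
      by (simp only: eq norm_scaleR)
    also have "2 * K / e < l" using N n by (simp add: l_def)
    then have "K / l < e / 2" using l e by (simp add: field_simps)
    finally show ?thesis by (simp add: l_def)
  qed
  then show "\<exists>N. \<forall>n\<ge>N. norm (yosida (real (Suc n)) x - A x) < e" by blast
qed

end

section \<open>Strongly continuous unitary groups\<close>

lemma
  assumes U: "strongly_continuous_unitary_group U"
  shows group_0: "U 0 x = x"
    and group_add: "U (s + t) x = U s (U t x)"
    and group_cinner: "cinner (U t x) (U t y) = cinner x y"
    and group_norm: "norm (U t x) = norm x"
  using assms
  by (auto simp: strongly_continuous_unitary_group_def unitary_op_def norm_eq_sqrt_cinner)

lemma group_inverse:
  assumes U: "strongly_continuous_unitary_group U"
  shows "U t (U (- t) x) = x" "U (- t) (U t x) = x"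
  using group_add[OF U, of t "- t" x] group_add[OF U, of "- t" t x] group_0[OF U] by simp_all

lemma group_adjoint:
  assumes U: "strongly_continuous_unitary_group U"
  shows "cinner (U t x) y = cinner x (U (- t) y)"
  using group_cinner[OF U, of t x "U (- t) y"] by (simp add: group_inverse[OF U])

lemma group_generator_solution:
  assumes U: "strongly_continuous_unitary_group U" and xy: "(x, y) \<in> generator_graph U"
  shows "((\<lambda>t. U t x) has_vector_derivative U t y) (at t)"
    and "(U t x, U t y) \<in> generator_graph U"
proof -
  have lim: "((\<lambda>h. (1 / h) *\<^sub>R (U h x - x)) \<longlongrightarrow> y) (at 0)"
    using xy by (simp add: generator_graph_def)
  have eq1: "U t ((1 / h) *\<^sub>R (U h x - x)) = (1 / h) *\<^sub>R (U h (U t x) - U t x)" for h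
    by (simp add: blinfun.diff_right blinfun.scaleR_right group_add[OF U, symmetric] add.commute)
  have "((\<lambda>h. U t ((1 / h) *\<^sub>R (U h x - x))) \<longlongrightarrow> U t y) (at 0)"
    by (intro blinfun.tendsto tendsto_const lim)
  then have *: "((\<lambda>h. (1 / h) *\<^sub>R (U h (U t x) - U t x)) \<longlongrightarrow> U t y) (at 0)"
    by (simp only: eq1)
  then show "(U t x, U t y) \<in> generator_graph U" by (simp add: generator_graph_def)
  have "U (t + h) x = U h (U t x)" for h
    by (subst add.commute) (rule group_add[OF U])
  then show "((\<lambda>t. U t x) has_vector_derivative U t y) (at t)"
    using * by (simp add: has_vector_derivative_iff_difference_quotient)
qed

context skew_adjoint
begin

definition yosida_group :: "nat \<Rightarrow> real \<Rightarrow> 'a \<Rightarrow>\<^sub>L 'a" where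
  "yosida_group n = blinfun_exp (yosida (real (Suc n)))"

lemma skew_yosida_Suc: "skew (yosida (real (Suc n)))"
  by (rule skew_yosida) simp

lemma norm_yosida_group: "norm (yosida_group n t x) = norm x"
  unfolding yosida_group_def by (rule norm_blinfun_exp_apply[OF skew_yosida_Suc])

text \<open>Strong continuity at \<open>0\<close>, uniformly in the approximation index: the constant \<open>K\<close> is the norm of \<open>A z\<close>
  for a vector \<open>z\<close> of the domain near \<open>y\<close>, so the estimate survives the passage to the limit.\<close>

lemma yosida_group_near_id:
  assumes e: "e > 0"
  obtains K where "K \<ge> 0" "\<And>n t. norm (yosida_group n t y - y) \<le> e + \<bar>t\<bar> * K"
proof -
  obtain z where z: "z \<in> S" "norm (y - z) < e / 2" using dense_approx[of "e / 2" y] e by auto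
  show ?thesis
  proof (rule that[of "norm (A z)"])
    fix n t
    have "norm (yosida_group n t z - z) \<le> \<bar>t\<bar> * norm (yosida (real (Suc n)) z)"
      unfolding yosida_group_def by (rule norm_blinfun_exp_minus_id_le[OF skew_yosida_Suc])
    also have "\<dots> \<le> \<bar>t\<bar> * norm (A z)"
      by (intro mult_left_mono norm_yosida_le z) auto
    finally have 1: "norm (yosida_group n t z - z) \<le> \<bar>t\<bar> * norm (A z)" .
    have "yosida_group n t y - y = yosida_group n t (y - z) + (yosida_group n t z - z) - (y - z)"
      by (simp add: blinfun.diff_right)
    also have "norm \<dots> \<le> norm (yosida_group n t (y - z)) + norm (yosida_group n t z - z) + norm (y - z)"
      by (meson norm_triangle_le_diff norm_triangle_ineq add_right_mono order_trans)
    finally show "norm (yosida_group n t y - y) \<le> e + \<bar>t\<bar> * norm (A z)"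
      using 1 z(2) by (simp add: norm_yosida_group)
  qed simp
qed

text \<open>For a vector \<open>z\<close> of the domain the sequence is Cauchy because \<open>yosida (real (Suc n)) z\<close> is; isometry
  transfers this to every vector by density.\<close>

lemma yosida_group_convergent: "convergent (\<lambda>n. yosida_group n t x)"
proof (rule Cauchy_convergent, rule metric_CauchyI)
  fix e :: real assume e: "e > 0"
  obtain z where z: "z \<in> S" "norm (x - z) < e / 4" using dense_approx[of "e / 4" x] e by auto
  define d where "d = e / (2 * (\<bar>t\<bar> + 1))"
  have d: "d > 0" using e by (simp add: d_def)
  obtain M where M: "\<And>m n. m \<ge> M \<Longrightarrow> n \<ge> M \<Longrightarrow>
      dist (yosida (real (Suc m)) z) (yosida (real (Suc n)) z) < d"
    using metric_CauchyD[OF LIMSEQ_imp_Cauchy[OF yosida_tendsto[OF z(1)]] d] by blast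
  have "dist (yosida_group m t x) (yosida_group n t x) < e" if mn: "m \<ge> M" "n \<ge> M" for m n
  proof -
    have "norm (yosida_group m t z - yosida_group n t z) \<le>
        \<bar>t\<bar> * norm (yosida (real (Suc m)) z - yosida (real (Suc n)) z)"
      unfolding yosida_group_def
      by (intro norm_blinfun_exp_diff_le skew_yosida_Suc yosida_commute) auto
    also have "\<dots> \<le> \<bar>t\<bar> * d" using M[OF mn] by (intro mult_left_mono) (auto simp: dist_norm)
    also have "\<dots> \<le> e / 2" using e by (simp add: d_def field_simps)
    finally have 1: "norm (yosida_group m t z - yosida_group n t z) \<le> e / 2" .
    have "yosida_group m t x - yosida_group n t x = yosida_group m t (x - z) +
        (yosida_group m t z - yosida_group n t z) - yosida_group n t (x - z)"
      by (simp add: blinfun.diff_right)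
    also have "norm \<dots> \<le> norm (yosida_group m t (x - z)) +
        norm (yosida_group m t z - yosida_group n t z) + norm (yosida_group n t (x - z))"
      by (meson norm_triangle_le_diff norm_triangle_ineq add_right_mono order_trans)
    finally show ?thesis using 1 z(2) by (simp add: norm_yosida_group dist_norm)
  qed
  then show "\<exists>M. \<forall>m\<ge>M. \<forall>n\<ge>M. dist (yosida_group m t x) (yosida_group n t x) < e" by blast
qed

definition unitary_group :: "real \<Rightarrow> 'a \<Rightarrow>\<^sub>L 'a" where
  "unitary_group t = Blinfun (\<lambda>x. lim (\<lambda>n. yosida_group n t x))"

lemma yosida_group_tendsto: "(\<lambda>n. yosida_group n t x) \<longlonglongrightarrow> unitary_group t x"
proof -
  let ?U = "\<lambda>x. lim (\<lambda>n. yosida_group n t x)"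
  have lim: "(\<lambda>n. yosida_group n t x) \<longlonglongrightarrow> ?U x" for x
    using yosida_group_convergent convergent_LIMSEQ_iff by blast
  have "bounded_linear ?U"
  proof (rule bounded_linear_intro)
    fix x y r
    show "?U (x + y) = ?U x + ?U y"
      using lim[of "x + y"] tendsto_add[OF lim[of x] lim[of y]]
      by (simp add: blinfun.add_right LIMSEQ_unique)
    show "?U (r *\<^sub>R x) = r *\<^sub>R ?U x"
      using lim[of "r *\<^sub>R x"] tendsto_scaleR[OF tendsto_const[of r] lim[of x]]
      by (simp add: blinfun.scaleR_right LIMSEQ_unique)
    show "norm (?U x) \<le> norm x * 1"
      using tendsto_norm[OF lim[of x]] by (simp add: norm_yosida_group LIMSEQ_const_iff)
  qed
  then show ?thesis using lim by (simp add: unitary_group_def bounded_linear_Blinfun_apply)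
qed

lemma norm_unitary_group: "norm (unitary_group t x) = norm x"
  using tendsto_norm[OF yosida_group_tendsto[of t x]] by (simp add: norm_yosida_group LIMSEQ_const_iff)

lemma unitary_group_add: "unitary_group (s + t) x = unitary_group s (unitary_group t x)"
proof -
  let ?y = "unitary_group t x"
  have "(\<lambda>n. norm (yosida_group n s (yosida_group n t x - ?y))) \<longlonglongrightarrow> 0"
    unfolding norm_yosida_group using yosida_group_tendsto LIM_zero tendsto_norm_zero by blast
  then have "(\<lambda>n. yosida_group n s (yosida_group n t x - ?y) + yosida_group n s ?y) \<longlonglongrightarrow> 0 + unitary_group s ?y"
    by (intro tendsto_add yosida_group_tendsto) (rule tendsto_norm_zero_cancel)
  then have "(\<lambda>n. yosida_group n (s + t) x) \<longlonglongrightarrow> unitary_group s ?y"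
    by (simp add: blinfun.diff_right yosida_group_def blinfun_exp_add skew_yosida_Suc del: of_nat_Suc)
  then show ?thesis using yosida_group_tendsto LIMSEQ_unique by blast
qed

lemma unitary_group_0: "unitary_group 0 x = x"
  using yosida_group_tendsto[of 0 x] by (simp add: yosida_group_def LIMSEQ_const_iff)

lemma unitary_group_scaleC: "unitary_group t (c *\<^sub>C x) = c *\<^sub>C unitary_group t x"
proof -
  have "c *\<^sub>C yosida_group n t x = yosida_group n t (c *\<^sub>C x)" for n
    unfolding yosida_group_def
    by (rule blinfun_exp_commute[OF skew_yosida_Suc _ bounded_linear_scaleC]) (simp add: yosida_scaleC)
  then have "(\<lambda>n. yosida_group n t (c *\<^sub>C x)) \<longlonglongrightarrow> c *\<^sub>C unitary_group t x"
    using bounded_linear.tendsto[OF bounded_linear_scaleC yosida_group_tendsto, of c t x] by simp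
  then show ?thesis using yosida_group_tendsto LIMSEQ_unique by blast
qed

lemma unitary_group_near_id:
  assumes e: "e > 0"
  obtains K where "\<And>t. norm (unitary_group t y - y) \<le> e + \<bar>t\<bar> * K"
proof -
  obtain K where K: "\<And>n t. norm (yosida_group n t y - y) \<le> e + \<bar>t\<bar> * K"
    using yosida_group_near_id[OF e] by blast
  have "(\<lambda>n. norm (yosida_group n t y - y)) \<longlonglongrightarrow> norm (unitary_group t y - y)" for t
    by (intro tendsto_intros yosida_group_tendsto)
  then have "norm (unitary_group t y - y) \<le> e + \<bar>t\<bar> * K" for t
    by (rule Lim_bounded[where M = 0]) (use K in auto)
  then show ?thesis using that by blast
qed

text \<open>The first-order remainder of each approximating group is controlled by how far the group moves the
  velocity, which is close to \<open>A x\<close>; the limit \<open>n \<rightarrow> \<infinity>\<close> removes the error \<open>\<delta> n\<close> made in replacing it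
  by \<open>A x\<close>.\<close>

lemma unitary_group_linearization:
  assumes x: "x \<in> S" and e: "e > 0"
  obtains K where "\<And>t. norm (unitary_group t x - x - t *\<^sub>R A x) \<le> \<bar>t\<bar> * (e + \<bar>t\<bar> * K)"
proof -
  obtain K where K0: "K \<ge> 0" and K: "\<And>n t. norm (yosida_group n t (A x) - A x) \<le> e + \<bar>t\<bar> * K"
    using yosida_group_near_id[OF e] by blast
  show ?thesis
  proof (rule that)
    fix t
    define \<delta> where "\<delta> n = norm (yosida (real (Suc n)) x - A x)" for n
    have \<delta>: "\<delta> \<longlonglongrightarrow> 0"
      unfolding \<delta>_def using yosida_tendsto[OF x] LIM_zero tendsto_norm_zero by blast
    have le: "norm (yosida_group n t x - x - t *\<^sub>R yosida (real (Suc n)) x) \<le> \<bar>t\<bar> * (2 * \<delta> n + (e + \<bar>t\<bar> * K))" for n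
      unfolding yosida_group_def
    proof (rule norm_blinfun_exp_linearization_le[OF skew_yosida_Suc])
      fix s assume s: "\<bar>s\<bar> \<le> \<bar>t\<bar>"
      let ?B = "yosida (real (Suc n))"
      have "yosida_group n s (?B x) - ?B x =
          yosida_group n s (?B x - A x) + (yosida_group n s (A x) - A x) - (?B x - A x)"
        by (simp add: blinfun.diff_right)
      also have "norm \<dots> \<le> norm (yosida_group n s (?B x - A x)) + norm (yosida_group n s (A x) - A x) + norm (?B x - A x)"
        by (meson norm_triangle_le_diff norm_triangle_ineq add_right_mono order_trans)
      also have "\<dots> \<le> \<delta> n + (e + \<bar>s\<bar> * K) + \<delta> n"
        using K[of n s] by (simp add: \<delta>_def norm_yosida_group)
      also have "\<dots> \<le> 2 * \<delta> n + (e + \<bar>t\<bar> * K)" using mult_right_mono[OF s K0] by simp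
      finally show "norm (blinfun_exp ?B s (?B x) - ?B x) \<le> 2 * \<delta> n + (e + \<bar>t\<bar> * K)"
        by (simp add: yosida_group_def)
    qed
    have "(\<lambda>n. \<bar>t\<bar> * (2 * \<delta> n + (e + \<bar>t\<bar> * K))) \<longlonglongrightarrow> \<bar>t\<bar> * (2 * 0 + (e + \<bar>t\<bar> * K))"
      by (intro tendsto_intros \<delta>)
    moreover have "(\<lambda>n. norm (yosida_group n t x - x - t *\<^sub>R yosida (real (Suc n)) x))
        \<longlonglongrightarrow> norm (unitary_group t x - x - t *\<^sub>R A x)"
      by (intro tendsto_intros yosida_group_tendsto yosida_tendsto x)
    ultimately show "norm (unitary_group t x - x - t *\<^sub>R A x) \<le> \<bar>t\<bar> * (e + \<bar>t\<bar> * K)"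
      using le LIMSEQ_le by fastforce
  qed
qed

lemma strongly_continuous_unitary_group: "strongly_continuous_unitary_group unitary_group"
  unfolding strongly_continuous_unitary_group_def
proof (intro conjI allI)
  have BH: "unitary_group t \<in> BH" for t by (simp add: BH_def unitary_group_scaleC)
  show "unitary_op (unitary_group t)" for t
    unfolding unitary_op_def
  proof (intro conjI allI BH)
    have "unitary_group t (unitary_group (- t) x) = x" for x
      using unitary_group_add[of t "- t" x] by (simp add: unitary_group_0)
    then show "surj (blinfun_apply (unitary_group t))" by (metis surjI)
    show "cinner (unitary_group t x) (unitary_group t y) = cinner x y" for x y
      by (rule cinner_isometry[OF norm_unitary_group BH])
  qed
  show "unitary_group 0 = id_blinfun" by (rule blinfun_eqI) (simp add: unitary_group_0)
  show "unitary_group (s + t) = unitary_group s o\<^sub>L unitary_group t" for s t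
    by (rule blinfun_eqI) (simp add: unitary_group_add)
  show "continuous_on UNIV (\<lambda>t. unitary_group t x)" for x
  proof (subst continuous_on_iff, intro ballI allI impI)
    fix t e :: real assume e: "e > 0"
    obtain K where K: "\<And>t. norm (unitary_group t x - x) \<le> e / 2 + \<bar>t\<bar> * K"
      using unitary_group_near_id[of "e / 2" x] e by auto
    define d where "d = e / (2 * (\<bar>K\<bar> + 1))"
    have d: "d > 0" using e by (simp add: d_def)
    have "dist (unitary_group s x) (unitary_group t x) < e" if "dist s t < d" for s
    proof -
      have "unitary_group s x - unitary_group t x = unitary_group t (unitary_group (s - t) x - x)"
        using unitary_group_add[of t "s - t" x] by (simp add: blinfun.diff_right)
      then have "dist (unitary_group s x) (unitary_group t x) \<le> e / 2 + \<bar>s - t\<bar> * K"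
        using K[of "s - t"] by (simp add: dist_norm norm_unitary_group)
      also have "\<bar>s - t\<bar> * K \<le> \<bar>s - t\<bar> * (\<bar>K\<bar> + 1)" by (intro mult_left_mono) auto
      also have "\<dots> < d * (\<bar>K\<bar> + 1)" using that by (intro mult_strict_right_mono) (auto simp: dist_real_def)
      also have "\<dots> = e / 2" by (simp add: d_def field_simps)
      finally show ?thesis by simp
    qed
    then show "\<exists>d>0. \<forall>s\<in>UNIV. dist s t < d \<longrightarrow> dist (unitary_group s x) (unitary_group t x) < e"
      using d by blast
  qed
qed

lemma derivative_unitary_group_on_domain:
  assumes x: "x \<in> S"
  shows "((\<lambda>t. (1 / t) *\<^sub>R (unitary_group t x - x)) \<longlongrightarrow> A x) (at 0)"
proof (rule LIM_I)
  fix e :: real assume e: "e > 0"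
  obtain K where K: "\<And>t. norm (unitary_group t x - x - t *\<^sub>R A x) \<le> \<bar>t\<bar> * (e / 2 + \<bar>t\<bar> * K)"
    using unitary_group_linearization[OF x, of "e / 2"] e by auto
  define d where "d = e / (2 * (\<bar>K\<bar> + 1))"
  have d: "d > 0" using e by (simp add: d_def)
  have "norm ((1 / t) *\<^sub>R (unitary_group t x - x) - A x) < e" if t: "t \<noteq> 0 \<and> norm (t - 0) < d" for t
  proof -
    have "(1 / t) *\<^sub>R (unitary_group t x - x) - A x = (1 / t) *\<^sub>R (unitary_group t x - x - t *\<^sub>R A x)"
      using t by (simp add: scaleR_diff_right)
    then have "norm ((1 / t) *\<^sub>R (unitary_group t x - x) - A x) =
        norm (unitary_group t x - x - t *\<^sub>R A x) / \<bar>t\<bar>" by simp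
    also have "\<dots> \<le> \<bar>t\<bar> * (e / 2 + \<bar>t\<bar> * K) / \<bar>t\<bar>"
      by (intro divide_right_mono K) auto
    also have "\<dots> = e / 2 + \<bar>t\<bar> * K" using t by simp
    also have "\<bar>t\<bar> * K \<le> \<bar>t\<bar> * (\<bar>K\<bar> + 1)" by (intro mult_left_mono) auto
    also have "\<dots> < d * (\<bar>K\<bar> + 1)" using t by (intro mult_strict_right_mono) auto
    also have "\<dots> = e / 2" by (simp add: d_def field_simps)
    finally show ?thesis by simp
  qed
  then show "\<exists>d>0. \<forall>t. t \<noteq> 0 \<and> norm (t - 0) < d \<longrightarrow>
      norm ((1 / t) *\<^sub>R (unitary_group t x - x) - A x) < e" using d by blast
qed

text \<open>The generator extends \<open>A\<close> by the linearization estimate.  Being the generator of a unitary group it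
  is skew-symmetric, and every skew-symmetric extension of \<open>A\<close> lies in minus the adjoint of \<open>A\<close>, that
  is, in \<open>A\<close> itself.\<close>

lemma generator_unitary_group: "generator_graph unitary_group = op_graph S A"
proof (intro equalityI subrelI)
  fix x y assume "(x, y) \<in> op_graph S A"
  then have "x \<in> S" "y = A x" by (auto simp: op_graph_def)
  then show "(x, y) \<in> generator_graph unitary_group"
    using derivative_unitary_group_on_domain by (simp add: generator_graph_def)
next
  note U = strongly_continuous_unitary_group
  fix x y assume "(x, y) \<in> generator_graph unitary_group"
  then have lim: "((\<lambda>t. (1 / t) *\<^sub>R (unitary_group t x - x)) \<longlongrightarrow> y) (at 0)"
    by (simp add: generator_graph_def)
  have "x \<in> S \<and> A x = y"
  proof (rule adjoint_subset)
    fix w assume w: "w \<in> S"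
    have "((\<lambda>t. cinner ((1 / t) *\<^sub>R (unitary_group t w - w)) x) \<longlongrightarrow> cinner (A w) x) (at 0)"
      by (intro cinner.tendsto tendsto_const derivative_unitary_group_on_domain w)
    moreover have "cinner ((1 / t) *\<^sub>R (unitary_group t w - w)) x =
        - cinner w ((1 / (- t)) *\<^sub>R (unitary_group (- t) x - x))" for t
      by (simp add: cinner.scaleR_left cinner.scaleR_right cinner.diff_left cinner.diff_right
          cinner.minus_right group_adjoint[OF U])
    moreover have "filterlim uminus (at 0) (at (0::real))"
      by (auto simp: filterlim_at eventually_at_filter intro!: tendsto_eq_intros)
    then have "((\<lambda>t. (1 / (- t)) *\<^sub>R (unitary_group (- t) x - x)) \<longlongrightarrow> y) (at 0)"
      by (rule filterlim_compose[OF lim])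
    then have "((\<lambda>t. - cinner w ((1 / (- t)) *\<^sub>R (unitary_group (- t) x - x))) \<longlongrightarrow> - cinner w y) (at 0)"
      by (intro cinner.tendsto tendsto_minus tendsto_const)
    ultimately show "cinner (A w) x = - cinner w y"
      by (simp add: tendsto_unique[OF trivial_limit_at])
  qed
  then show "(x, y) \<in> op_graph S A" by (auto simp: op_graph_def)
qed

text \<open>The two orbits of a vector of the domain solve the same evolution equation, so the norm of their
  difference is conserved; both groups are continuous operators, hence agree by density.\<close>

lemma unitary_group_unique:
  assumes U: "strongly_continuous_unitary_group U" "generator_graph U = op_graph S A"
    and V: "strongly_continuous_unitary_group V" "generator_graph V = op_graph S A"
  shows "U = V"
proof -
  have eqS: "U t x = V t x" if x: "x \<in> S" for t x
  proof -
    have orbit: "W t x \<in> S \<and> W t (A x) = A (W t x)" "((\<lambda>t. W t x) has_vector_derivative A (W t x)) (at t)"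
      if "strongly_continuous_unitary_group W" "generator_graph W = op_graph S A" for W t
    proof -
      have g: "(x, A x) \<in> generator_graph W" using x that(2) by (simp add: op_graph_def)
      show 1: "W t x \<in> S \<and> W t (A x) = A (W t x)"
        using group_generator_solution(2)[OF that(1) g, of t] that(2) by (simp add: op_graph_def)
      show "((\<lambda>t. W t x) has_vector_derivative A (W t x)) (at t)"
        using group_generator_solution(1)[OF that(1) g, of t] 1 by simp
    qed
    have "norm (U t x - V t x) = norm (U 0 x - V 0 x)"
    proof (rule norm_constant_if_velocity_orthogonal)
      fix t
      show "((\<lambda>t. U t x - V t x) has_vector_derivative A (U t x) - A (V t x)) (at t)"
        by (intro has_vector_derivative_diff orbit U V)
      have "U t x \<in> S" "V t x \<in> S" using orbit(1)[OF U, of t] orbit(1)[OF V, of t] by auto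
      then show "Re (cinner (A (U t x) - A (V t x)) (U t x - V t x)) = 0"
        using Re_cinner_A[OF diff_mem] by (simp add: A_diff)
    qed
    then show ?thesis by (simp add: group_0[OF U(1)] group_0[OF V(1)])
  qed
  have "U t x = V t x" for t x
  proof -
    have "closed {x. U t x = V t x}" by (intro closed_Collect_eq continuous_intros)
    then have "closure S \<subseteq> {x. U t x = V t x}" using eqS by (intro closure_minimal) auto
    then show ?thesis using dense by auto
  qed
  then show ?thesis by (intro ext blinfun_eqI) auto
qed

end

lemma self_adjoint_imp_skew_adjoint:
  assumes "self_adjoint S D"
  shows "skew_adjoint S (\<lambda>x. \<i> *\<^sub>C D x)"
proof
  have dd: "densely_defined_operator S D" and adj: "adjoint_graph S D = op_graph S D"
    using assms by (auto simp: self_adjoint_def)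
  show "0 \<in> S" "closure S = UNIV" using dd by (auto simp: densely_defined_operator_def)
  show "x + y \<in> S" "\<i> *\<^sub>C D (x + y) = \<i> *\<^sub>C D x + \<i> *\<^sub>C D y" if "x \<in> S" "y \<in> S" for x y
    using dd that by (auto simp: densely_defined_operator_def scaleC_add_right)
  show "c *\<^sub>C x \<in> S" "\<i> *\<^sub>C D (c *\<^sub>C x) = c *\<^sub>C \<i> *\<^sub>C D x" if "x \<in> S" for c x
    using dd that by (auto simp: densely_defined_operator_def scaleC_scaleC mult.commute)
  show "cinner (\<i> *\<^sub>C D x) y = - cinner x (\<i> *\<^sub>C D y)" if "x \<in> S" "y \<in> S" for x y
  proof -
    have "(y, D y) \<in> adjoint_graph S D" using that by (auto simp: adj op_graph_def)
    then show ?thesis using that by (simp add: adjoint_graph_def cinner_scaleC_left cinner_scaleC_right)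
  qed
  fix y z assume *: "\<And>x. x \<in> S \<Longrightarrow> cinner (\<i> *\<^sub>C D x) y = - cinner x z"
  have "cinner (D x) y = cinner x (- \<i> *\<^sub>C z)" if "x \<in> S" for x
  proof -
    have "- \<i> * (\<i> * cinner (D x) y) = - \<i> * - cinner x z"
      using *[OF that] by (simp only: cinner_scaleC_left)
    then show ?thesis by (simp add: cinner_scaleC_right)
  qed
  then have "(y, - \<i> *\<^sub>C z) \<in> op_graph S D" unfolding adj[symmetric] by (simp add: adjoint_graph_def)
  then have "y \<in> S" "D y = - \<i> *\<^sub>C z" by (auto simp: op_graph_def)
  then show "y \<in> S \<and> \<i> *\<^sub>C D y = z"
    using scaleC_of_real[of 1 z] by (simp add: scaleC_scaleC)
qed

text \<open>Stone's theorem, in the form that the definite description defining \<open>exp_i\<close> is satisfied.\<close>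

theorem Stone:
  assumes "self_adjoint S (D :: 'a::chilbert_space \<Rightarrow> 'a)"
  shows "strongly_continuous_unitary_group (exp_i S D)"
proof -
  interpret skew_adjoint S "\<lambda>x. \<i> *\<^sub>C D x"
    by (rule self_adjoint_imp_skew_adjoint[OF assms])
  have "\<exists>!U. strongly_continuous_unitary_group U \<and> generator_graph U = op_graph S (\<lambda>x. \<i> *\<^sub>C D x)"
    using strongly_continuous_unitary_group generator_unitary_group unitary_group_unique by blast
  from theI'[OF this] show ?thesis unfolding exp_i_def by blast
qed

section \<open>The flow on bounded operators\<close>

lemma flow_diff: "flow S D t (a - b) = flow S D t a - flow S D t b"
  by (rule blinfun_eqI) (simp add: flow_def blinfun.diff_left blinfun.diff_right)

lemma flow_scaleR: "flow S D t (r *\<^sub>R a) = r *\<^sub>R flow S D t a"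
  by (rule blinfun_eqI) (simp add: flow_def blinfun.scaleR_left blinfun.scaleR_right)

lemma
  assumes U: "strongly_continuous_unitary_group (exp_i S D)"
  shows flow_0: "flow S D 0 a = a"
    and flow_add: "flow S D (s + t) a = flow S D s (flow S D t a)"
proof -
  show "flow S D 0 a = a" by (rule blinfun_eqI) (simp add: flow_def group_0[OF U])
  show "flow S D (s + t) a = flow S D s (flow S D t a)"
    by (rule blinfun_eqI) (simp only: flow_def blinfun_apply_blinfun_compose minus_add group_add[OF U])
qed

lemma norm_flow:
  assumes U: "strongly_continuous_unitary_group (exp_i S D)"
  shows "norm (flow S D t a) = norm a"
proof (rule antisym)
  have le: "norm (flow S D t a) \<le> norm a" for t a
  proof (rule norm_blinfun_bound)
    show "norm (flow S D t a x) \<le> norm a * norm x" for x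
      using norm_blinfun[of a "exp_i S D (- t) x"] by (simp add: flow_def group_norm[OF U])
  qed simp
  show "norm (flow S D t a) \<le> norm a" by (rule le)
  show "norm a \<le> norm (flow S D t a)"
    using le[of "- t" "flow S D t a"] by (simp add: flow_add[OF U, symmetric] flow_0[OF U])
qed

lemma has_weak_derivative_iff_tendsto:
  "has_weak_derivative S D a b \<longleftrightarrow> b \<in> BH \<and>
     (\<forall>\<xi> \<eta>. ((\<lambda>t. cinner ((1 / t) *\<^sub>R (flow S D t a - a) \<xi>) \<eta>) \<longlongrightarrow> cinner (b \<xi>) \<eta>) (at 0))"
  unfolding has_weak_derivative_def
  by (simp add: tendsto_norm_zero_iff LIM_zero_iff blinfun.diff_left blinfun.scaleR_left cinner.diff_left)

lemma weak_derivative_eqI: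
  assumes "has_weak_derivative S D a b"
  shows "weak_derivative S D a = b"
  unfolding weak_derivative_def
proof (rule the_equality)
  show "has_weak_derivative S D a b" by (rule assms)
  fix c assume c: "has_weak_derivative S D a c"
  have coeff: "cinner (c \<xi>) \<eta> = cinner (b \<xi>) \<eta>" for \<xi> \<eta>
    using c assms tendsto_unique[OF trivial_limit_at] unfolding has_weak_derivative_iff_tendsto by blast
  show "c = b" by (rule blinfun_eqI, rule cinner_eqI, rule coeff)
qed

lemma uniform_imp_has_weak_derivative:
  assumes b: "b \<in> BH" and lim: "((\<lambda>t. (1 / t) *\<^sub>R (flow S D t a - a)) \<longlongrightarrow> b) (at 0)"
  shows "has_weak_derivative S D a b"
  unfolding has_weak_derivative_iff_tendsto
proof (intro conjI b allI)
  fix \<xi> \<eta>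
  have "((\<lambda>t. cinner (((1 / t) *\<^sub>R (flow S D t a - a)) \<xi>) \<eta>) \<longlongrightarrow> cinner (b \<xi>) \<eta>) (at 0)"
    by (intro cinner.tendsto blinfun.tendsto tendsto_const lim)
  then show "((\<lambda>t. cinner ((1 / t) *\<^sub>R (flow S D t a - a) \<xi>) \<eta>) \<longlongrightarrow> cinner (b \<xi>) \<eta>) (at 0)"
    by (simp add: blinfun.scaleR_left)
qed

text \<open>As the flow is isometric, the difference quotients at \<open>t\<close> converge to \<open>flow S D t b\<close> uniformly in
  \<open>t\<close>.  This convergence is used twice: pointwise it gives the continuity of \<open>\<lambda>t. flow S D t a\<close>, hence of
  the quotients, and its uniformity carries continuity over to the limit.\<close>

lemma uniform_derivative_flow_continuous:
  assumes U: "strongly_continuous_unitary_group (exp_i S D)"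
    and lim: "((\<lambda>t. (1 / t) *\<^sub>R (flow S D t a - a)) \<longlongrightarrow> b) (at 0)"
  shows "continuous_on UNIV (\<lambda>t. flow S D t b)"
proof -
  define q where "q h t = flow S D t ((1 / h) *\<^sub>R (flow S D h a - a))" for h t
  have q: "q h t = (1 / h) *\<^sub>R (flow S D (t + h) a - flow S D t a)" for h t
    by (simp add: q_def flow_scaleR flow_diff flow_add[OF U])
  have ul: "uniform_limit UNIV q (\<lambda>t. flow S D t b) (at 0)"
  proof (rule uniform_limitI)
    fix e :: real assume "e > 0"
    then have "\<forall>\<^sub>F h in at 0. dist ((1 / h) *\<^sub>R (flow S D h a - a)) b < e"
      by (rule tendstoD[OF lim])
    then show "\<forall>\<^sub>F h in at 0. \<forall>t\<in>UNIV. dist (q h t) (flow S D t b) < e"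
      by eventually_elim (simp only: q_def dist_norm flow_diff[symmetric] norm_flow[OF U] simp_thms ball_simps)
  qed
  have "((\<lambda>t. flow S D t a) has_vector_derivative flow S D t b) (at t)" for t
    using tendsto_uniform_limitI[OF ul, of t]
    by (simp add: has_vector_derivative_iff_difference_quotient q)
  then have cont: "continuous_on UNIV (\<lambda>t. flow S D t a)"
    using continuous_at_imp_continuous_on has_vector_derivative_continuous by blast
  show ?thesis
  proof (rule uniform_limit_theorem[OF _ ul])
    have "continuous_on UNIV (\<lambda>t. flow S D (t + h) a)" for h
      by (rule continuous_on_compose2[OF cont]) (auto intro!: continuous_intros)
    then show "\<forall>\<^sub>F h in at 0. continuous_on UNIV (q h)"
      unfolding q by (intro always_eventually allI continuous_intros cont)
  qed simp
qed

text \<open>The weak derivative is only assumed at time \<open>0\<close>; moving the unitary group from the operator to both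
  vectors reduces time \<open>t\<close> to time \<open>0\<close>.\<close>

lemma has_vector_derivative_matrix_coefficient:
  assumes U: "strongly_continuous_unitary_group (exp_i S D)"
    and b: "has_weak_derivative S D a b"
  shows "((\<lambda>t. cinner (flow S D t a \<xi>) \<eta>) has_vector_derivative cinner (flow S D t b \<xi>) \<eta>) (at t)"
proof -
  let ?\<xi> = "exp_i S D (- t) \<xi>" and ?\<eta> = "exp_i S D (- t) \<eta>"
  have coeff: "cinner (flow S D t c \<xi>) \<eta> = cinner (c ?\<xi>) ?\<eta>" for c
    by (simp add: flow_def group_adjoint[OF U])
  have "(1 / h) *\<^sub>R (cinner (flow S D (t + h) a \<xi>) \<eta> - cinner (flow S D t a \<xi>) \<eta>) =
      cinner ((1 / h) *\<^sub>R (flow S D h a - a) ?\<xi>) ?\<eta>" for h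
    by (simp add: flow_add[OF U] coeff blinfun.diff_left cinner.scaleR_left cinner.diff_left)
  then show ?thesis
    using b by (simp add: has_vector_derivative_iff_difference_quotient coeff has_weak_derivative_iff_tendsto)
qed

text \<open>The mean value inequality for matrix coefficients is uniform in the vectors.  Pairing the remainder
  at \<open>\<xi>\<close> with itself turns it into a bound on the operator norm.\<close>

lemma norm_flow_increment_le:
  assumes U: "strongly_continuous_unitary_group (exp_i S D)"
    and b: "has_weak_derivative S D a b"
    and e: "\<And>s. \<bar>s\<bar> \<le> \<bar>t\<bar> \<Longrightarrow> norm (flow S D s b - b) \<le> e"
  shows "norm (flow S D t a - a - t *\<^sub>R b) \<le> \<bar>t\<bar> * e"
proof (rule norm_blinfun_bound)
  have "0 \<le> e" using e[of 0] norm_ge_zero order_trans by (metis abs_ge_zero abs_zero)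
  then show "0 \<le> \<bar>t\<bar> * e" by simp
  fix \<xi>
  let ?x = "(flow S D t a - a - t *\<^sub>R b) \<xi>"
  define f where "f s = cinner (flow S D s a \<xi>) ?x - s *\<^sub>R cinner (b \<xi>) ?x" for s
  have "(f has_vector_derivative cinner ((flow S D s b - b) \<xi>) ?x) (at s)" for s
    unfolding f_def
    using has_vector_derivative_matrix_coefficient[OF U b, of \<xi> ?x s]
    by (auto simp: blinfun.diff_left cinner.diff_left intro!: derivative_eq_intros)
  then have "norm (f t - f 0) \<le> \<bar>t\<bar> * (e * norm \<xi> * norm ?x)"
  proof (rule norm_increment_le)
    fix s assume s: "\<bar>s\<bar> \<le> \<bar>t\<bar>"
    have "norm (cinner ((flow S D s b - b) \<xi>) ?x) \<le> norm ((flow S D s b - b) \<xi>) * norm ?x"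
      by (rule norm_cinner_le)
    also have "\<dots> \<le> e * norm \<xi> * norm ?x"
      by (intro mult_right_mono order_trans[OF norm_blinfun] e s) auto
    finally show "norm (cinner ((flow S D s b - b) \<xi>) ?x) \<le> e * norm \<xi> * norm ?x" .
  qed
  moreover have "f t - f 0 = cinner ?x ?x"
    by (simp add: f_def flow_0[OF U] blinfun.diff_left blinfun.scaleR_left cinner.diff_left cinner.scaleR_left)
  moreover have "(norm ?x)\<^sup>2 \<le> norm (cinner ?x ?x)"
    using complex_Re_le_cmod by (simp add: power2_norm_eq_cinner)
  ultimately have "norm ?x * norm ?x \<le> (\<bar>t\<bar> * e * norm \<xi>) * norm ?x"
    by (simp add: power2_eq_square mult.assoc)
  then show "norm ?x \<le> \<bar>t\<bar> * e * norm \<xi>"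
    using \<open>0 \<le> e\<close> by (cases "?x = 0") auto
qed

theorem theorem4p1:
  fixes S :: "'a::chilbert_space set"
    and D :: "'a \<Rightarrow> 'a"
    and a :: "'a \<Rightarrow>\<^sub>L 'a"
  assumes "self_adjoint S D"
    and "a \<in> BH"
  shows "uniformly_differentiable S D a \<longleftrightarrow>
    weakly_differentiable S D a \<and>
    continuous_on UNIV (\<lambda>t. flow S D t (weak_derivative S D a))"
proof
  note U = Stone[OF assms(1)]
  show "weakly_differentiable S D a \<and> continuous_on UNIV (\<lambda>t. flow S D t (weak_derivative S D a))"
    if unif: "uniformly_differentiable S D a"
  proof -
    obtain b where b: "b \<in> BH" and lim: "((\<lambda>t. (1 / t) *\<^sub>R (flow S D t a - a)) \<longlongrightarrow> b) (at 0)"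
      using unif by (auto simp: uniformly_differentiable_def tendsto_norm_zero_iff LIM_zero_iff)
    have weak: "has_weak_derivative S D a b" by (rule uniform_imp_has_weak_derivative[OF b lim])
    moreover have "continuous_on UNIV (\<lambda>t. flow S D t (weak_derivative S D a))"
      using uniform_derivative_flow_continuous[OF U lim] by (simp add: weak_derivative_eqI[OF weak])
    ultimately show ?thesis unfolding weakly_differentiable_def by blast
  qed
  show "uniformly_differentiable S D a"
    if weak: "weakly_differentiable S D a \<and> continuous_on UNIV (\<lambda>t. flow S D t (weak_derivative S D a))"
  proof -
    obtain b where b: "has_weak_derivative S D a b" and cont: "continuous_on UNIV (\<lambda>t. flow S D t b)"
      using weak weak_derivative_eqI unfolding weakly_differentiable_def by metis
    have "((\<lambda>t. (1 / t) *\<^sub>R (flow S D t a - a)) \<longlongrightarrow> b) (at 0)"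
    proof (rule LIM_I)
      fix e :: real assume e: "e > 0"
      obtain d where d: "d > 0" and close: "\<And>s. dist s 0 < d \<Longrightarrow> dist (flow S D s b) (flow S D 0 b) < e / 2"
        using cont e unfolding continuous_on_iff by (metis UNIV_I half_gt_zero)
      have "norm ((1 / t) *\<^sub>R (flow S D t a - a) - b) < e" if t: "t \<noteq> 0 \<and> norm (t - 0) < d" for t
      proof -
        have "norm (flow S D t a - a - t *\<^sub>R b) \<le> \<bar>t\<bar> * (e / 2)"
        proof (rule norm_flow_increment_le[OF U b])
          fix s assume "\<bar>s\<bar> \<le> \<bar>t\<bar>"
          then show "norm (flow S D s b - b) \<le> e / 2"
            using close[of s] t by (simp add: dist_norm flow_0[OF U])
        qed
        moreover have "(1 / t) *\<^sub>R (flow S D t a - a) - b = (1 / t) *\<^sub>R (flow S D t a - a - t *\<^sub>R b)"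
          using t by (simp add: scaleR_diff_right)
        then have "norm ((1 / t) *\<^sub>R (flow S D t a - a) - b) = norm (flow S D t a - a - t *\<^sub>R b) / \<bar>t\<bar>"
          by simp
        ultimately have "norm ((1 / t) *\<^sub>R (flow S D t a - a) - b) \<le> e / 2"
          using t by (simp add: divide_le_eq mult.commute)
        then show ?thesis using e by simp
      qed
      then show "\<exists>d>0. \<forall>t. t \<noteq> 0 \<and> norm (t - 0) < d \<longrightarrow> norm ((1 / t) *\<^sub>R (flow S D t a - a) - b) < e"
        using d by blast
    qed
    moreover have "b \<in> BH" using b by (simp add: has_weak_derivative_def)
    ultimately show ?thesis
      by (auto simp: uniformly_differentiable_def tendsto_norm_zero_iff LIM_zero_iff)
  qed
qed

end
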